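(* Let $f_0,F:\mathbb{R}^n\times\mathbb{R}^d\to\mathbb{R}$ be twice continuously differentiable functions. For $w\in\mathbb{R}^d$ put $C(w)=\{x\in\mathbb{R}^n\mid F(x,w)\le 0\}$ and $$S(w)=\{x\in\mathbb{R}^n\mid 0\in\nabla_xf_0(x,w)+N_{C(w)}(x)\}.$$ Let $\bar w\in\mathbb{R}^d$ and $\bar x\in S(\bar w)$. Suppose that $F(\bar x,\bar w)=0$, that $\nabla_xF(\bar x,\bar w)\neq 0$, and that the Lagrange multiplier $\lambda$ corresponding to the stationary point $\bar x\in S(\bar w)$ (the unique $\lambda\ge 0$ with $\nabla_xf_0(\bar x,\bar w)+\lambda\nabla_xF(\bar x,\bar w)=0$) is zero. Put $$A'_1=\left[\nabla^2_{xx}f_0(\bar x,\bar w)\quad\nabla_xF(\bar x,\bar w)\right]\in\mathbb{R}^{n\times(n+1)},\qquad A'_2=\left[\nabla^2_{wx}f_0(\bar x,\bar w)\quad\nabla_wF(\bar x,\bar w)\right]\in\mathbb{R}^{d\times(n+1)},$$ $$\Delta_1=\{(v'_1,\gamma)\in\mathbb{R}^n\times\mathbb{R}\mid\nabla_xF(\bar x,\bar w)v'_1>0,\ \gamma\ge 0\},\qquad \Delta_2=\{v'_1\in\mathbb{R}^n\mid\nabla_xF(\bar x,\bar w)v'_1<0\},$$ $$\Delta_3=\{(v'_1,\gamma)\in\mathbb{R}^n\times\mathbb{R}\mid\nabla_xF(\bar x,\bar w)v'_1\ge 0,\ \gamma\ge 0\}.$$ The following assertions are true: (a) If $S$ is locally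 Lipschitz-like around $(\bar w,\bar x)$, then $\ker A'_1\cap\Delta_3\subset\ker A'_2$. (b) If the four conditions $$\begin{cases}\ker A'_1\cap\ker A'_2=\{0\},\\ \ker A'_1\cap\left(\ker\nabla_xF(\bar x,\bar w)\times\mathbb{R}\right)\subset\ker A'_2,\\ \ker A'_1\cap\Delta_1\subset\ker A'_2,\\ \ker\nabla^2_{xx}f_0(\bar x,\bar w)\cap\Delta_2\subset\ker\nabla^2_{wx}f_0(\bar x,\bar w)\end{cases}$$ are all fulfilled, then $S$ is locally Lipschitz-like around $(\bar w,\bar x)$.
   Context: Fréchet normal cone: for $\Omega\subset\mathbb{R}^s$ and $\bar v\in\Omega$, $\widehat N_\Omega(\bar v)=\{v'\in\mathbb{R}^s\mid \limsup_{v\to\bar v,\,v\in\Omega}\frac{\langle v',v-\bar v\rangle}{\|v-\bar v\|}\le 0\}$, and $\widehat N_\Omega(\bar v)=\emptyset$ if $\bar v\notin\Omega$. Mordukhovich (limiting) normal cone, for $\Omega$ locally closed around $\bar v\in\Omega$: $N_\Omega(\bar v)$ is the set of all $v'$ for which there are sequences $v_k\to\bar v$, $v'_k\to v'$ with $v'_k\in\widehat N_\Omega(v_k)$ for all $k$; $N_\Omega(\bar v)=\emptyset$ if $\bar v\notin\Omega$. The map $S:\mathbb{R}^d\rightrightarrows\mathbb{R}^n$ is the stationary point set map of the parametric problem of minimizing $f_0(x,w)$ subject to $F(x,w)\le 0$. Under $F(\bar x,\bar w)=0$, $\nabla_xF(\bar x,\bar w)\ne 0$ and $\bar x\in S(\bar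 w)$, the multiplier $\lambda$ exists and is unique; $\lambda=0$ means $\nabla_xf_0(\bar x,\bar w)=0$. $\nabla^2_{xx}f_0$ is the $n\times n$ Hessian in $x$ and $\nabla^2_{wx}f_0$ is the $d\times n$ matrix with entries $\partial^2f_0/\partial w_i\partial x_j$. In $A'_1,A'_2$ the gradients $\nabla_xF(\bar x,\bar w)$ and $\nabla_wF(\bar x,\bar w)$ are column vectors; $A'_1,A'_2$ act on pairs $(v'_1,\gamma)\in\mathbb{R}^n\times\mathbb{R}$. The notation $\nabla_xF(\bar x,\bar w)v'_1$ means $\langle\nabla_xF(\bar x,\bar w),v'_1\rangle$, and $\ker\nabla_xF(\bar x,\bar w)=\{v'_1\in\mathbb{R}^n\mid\nabla_xF(\bar x,\bar w)v'_1=0\}$. A multifunction $S:\mathbb{R}^d\rightrightarrows\mathbb{R}^n$ is locally Lipschitz-like around $(\bar w,\bar x)\in\mathrm{gph}\,S=\{(w,x)\mid x\in S(w)\}$ if there exist $\ell>0$ and neighborhoods $U$ of $\bar x$ and $V$ of $\bar w$ such that $S(w')\cap U\subset S(w)+\ell\|w'-w\|\bar B$ for all $w,w'\in V$, where $\bar B$ is the closed unit ball of $\mathbb{R}^n$. *)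

theory Defs
  imports "HOL-Analysis.Analysis"
begin

definition twice_continuously_differentiable :: "('a::real_normed_vector \<Rightarrow> real) \<Rightarrow> bool" where
  "twice_continuously_differentiable f \<longleftrightarrow>
     (\<exists>(f' :: 'a \<Rightarrow> ('a \<Rightarrow>\<^sub>L real)) (f'' :: 'a \<Rightarrow> ('a \<Rightarrow>\<^sub>L ('a \<Rightarrow>\<^sub>L real))).
        (\<forall>z. (f has_derivative blinfun_apply (f' z)) (at z)) \<and>
        (\<forall>z. (f' has_derivative blinfun_apply (f'' z)) (at z)) \<and>
        continuous_on UNIV f'')"

definition gradient :: "('a::real_inner \<Rightarrow> real) \<Rightarrow> 'a \<Rightarrow> 'a" where
  "gradient f z = (THE D. GDERIV f z :> D)"

definition grad_x :: "((real^'n) \<times> (real^'d) \<Rightarrow> real) \<Rightarrow> real^'n \<Rightarrow> real^'d \<Rightarrow> real^'n" where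
  "grad_x f x w = gradient (\<lambda>y. f (y, w)) x"

definition grad_w :: "((real^'n) \<times> (real^'d) \<Rightarrow> real) \<Rightarrow> real^'n \<Rightarrow> real^'d \<Rightarrow> real^'d" where
  "grad_w f x w = gradient (\<lambda>u. f (x, u)) w"

definition hess_xx :: "((real^'n) \<times> (real^'d) \<Rightarrow> real) \<Rightarrow> real^'n \<Rightarrow> real^'d \<Rightarrow> real^'n^'n" where
  "hess_xx f x w = jacobian (\<lambda>y. grad_x f y w) (at x)"

text \<open>The Jacobian in \<open>w\<close> of the \<open>x\<close>-gradient has entry
  \<open>\<partial>/\<partial>w\<^sub>i (\<partial>f/\<partial>x\<^sub>j)\<close> in row \<open>j\<close> and column \<open>i\<close>; its transpose is the
  \<open>d \<times> n\<close> matrix with that entry in row \<open>i\<close> and column \<open>j\<close>.\<close>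

definition hess_wx :: "((real^'n) \<times> (real^'d) \<Rightarrow> real) \<Rightarrow> real^'n \<Rightarrow> real^'d \<Rightarrow> real^'n^'d" where
  "hess_wx f x w = transpose (jacobian (\<lambda>u. grad_x f x u) (at w))"

text \<open>At an isolated point of \<open>\<Omega>\<close> the filter is trivial and the upper limit is \<open>-\<infinity>\<close>,
  so the cone is the whole space there, as usual.\<close>

definition frechet_normal_cone :: "'a::real_inner set \<Rightarrow> 'a \<Rightarrow> 'a set" where
  "frechet_normal_cone \<Omega> vbar =
     (if vbar \<in> \<Omega>
      then {v'. Limsup (at vbar within \<Omega>)
                  (\<lambda>v. ereal (inner v' (v - vbar) / norm (v - vbar))) \<le> 0}
      else {})"

text \<open>Intended for sets that are locally closed around the point; below it is only applied to
  the closed sets \<open>feasible_set F w\<close> with \<open>F\<close> continuous.\<close>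

definition limiting_normal_cone :: "'a::real_inner set \<Rightarrow> 'a \<Rightarrow> 'a set" where
  "limiting_normal_cone \<Omega> vbar =
     (if vbar \<in> \<Omega>
      then {v'. \<exists>v p. v \<longlonglongrightarrow> vbar \<and> p \<longlonglongrightarrow> v' \<and>
                 (\<forall>k::nat. p k \<in> frechet_normal_cone \<Omega> (v k))}
      else {})"

definition feasible_set :: "((real^'n) \<times> (real^'d) \<Rightarrow> real) \<Rightarrow> real^'d \<Rightarrow> (real^'n) set" where
  "feasible_set F w = {x. F (x, w) \<le> 0}"

definition stationary_set ::
  "((real^'n) \<times> (real^'d) \<Rightarrow> real) \<Rightarrow> ((real^'n) \<times> (real^'d) \<Rightarrow> real) \<Rightarrow> real^'d \<Rightarrow> (real^'n) set" where
  "stationary_set f0 F w =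
     {x. 0 \<in> (\<lambda>v. grad_x f0 x w + v) ` limiting_normal_cone (feasible_set F w) x}"

text \<open>Well defined when \<open>x\<close> is stationary for \<open>w\<close>, \<open>F (x, w) = 0\<close> and
  \<open>grad_x F x w \<noteq> 0\<close>: the multiplier then exists and is unique.\<close>

definition lagrange_multiplier ::
  "((real^'n) \<times> (real^'d) \<Rightarrow> real) \<Rightarrow> ((real^'n) \<times> (real^'d) \<Rightarrow> real) \<Rightarrow> real^'n \<Rightarrow> real^'d \<Rightarrow> real" where
  "lagrange_multiplier f0 F x w =
     (THE l. 0 \<le> l \<and> grad_x f0 x w + l *\<^sub>R grad_x F x w = 0)"

definition locally_lipschitz_like ::
  "('b::real_normed_vector \<Rightarrow> 'a::real_normed_vector set) \<Rightarrow> 'b \<Rightarrow> 'a \<Rightarrow> bool" where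
  "locally_lipschitz_like S wbar xbar \<longleftrightarrow>
     xbar \<in> S wbar \<and>
     (\<exists>l>0. \<exists>U V. xbar \<in> interior U \<and> wbar \<in> interior V \<and>
        (\<forall>w\<in>V. \<forall>w'\<in>V.
           S w' \<inter> U \<subseteq> {y + (l * norm (w' - w)) *\<^sub>R b | y b. y \<in> S w \<and> b \<in> cball 0 1}))"

text \<open>The block matrix \<open>[M b]\<close>, with \<open>b\<close> a column, as a linear map on pairs.\<close>

definition augmented :: "real^'n^'m \<Rightarrow> real^'m \<Rightarrow> (real^'n) \<times> real \<Rightarrow> real^'m" where
  "augmented M b = (\<lambda>(v, \<gamma>). M *v v + \<gamma> *\<^sub>R b)"

definition ker :: "('a \<Rightarrow> 'b::zero) \<Rightarrow> 'a set" where
  "ker T = {v. T v = 0}"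

definition A1 ::
  "((real^'n) \<times> (real^'d) \<Rightarrow> real) \<Rightarrow> ((real^'n) \<times> (real^'d) \<Rightarrow> real) \<Rightarrow> real^'n \<Rightarrow> real^'d
     \<Rightarrow> (real^'n) \<times> real \<Rightarrow> real^'n" where
  "A1 f0 F x w = augmented (hess_xx f0 x w) (grad_x F x w)"

definition A2 ::
  "((real^'n) \<times> (real^'d) \<Rightarrow> real) \<Rightarrow> ((real^'n) \<times> (real^'d) \<Rightarrow> real) \<Rightarrow> real^'n \<Rightarrow> real^'d
     \<Rightarrow> (real^'n) \<times> real \<Rightarrow> real^'d" where
  "A2 f0 F x w = augmented (hess_wx f0 x w) (grad_w F x w)"

definition Delta1 :: "((real^'n) \<times> (real^'d) \<Rightarrow> real) \<Rightarrow> real^'n \<Rightarrow> real^'d \<Rightarrow> ((real^'n) \<times> real) set" where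
  "Delta1 F x w = {(v, \<gamma>). inner (grad_x F x w) v > 0 \<and> \<gamma> \<ge> 0}"

definition Delta2 :: "((real^'n) \<times> (real^'d) \<Rightarrow> real) \<Rightarrow> real^'n \<Rightarrow> real^'d \<Rightarrow> (real^'n) set" where
  "Delta2 F x w = {v. inner (grad_x F x w) v < 0}"

definition Delta3 :: "((real^'n) \<times> (real^'d) \<Rightarrow> real) \<Rightarrow> real^'n \<Rightarrow> real^'d \<Rightarrow> ((real^'n) \<times> real) set" where
  "Delta3 F x w = {(v, \<gamma>). inner (grad_x F x w) v \<ge> 0 \<and> \<gamma> \<ge> 0}"

end

theory Submission
  imports Defs
begin

text \<open>
  Near \<open>(xbar, wbar)\<close> stationarity of \<open>x\<close> for \<open>w\<close> is the system
  \<open>\<nabla>\<^sub>x f0 + \<lambda> \<nabla>\<^sub>x F = 0\<close>, \<open>\<lambda> \<ge> 0\<close>, \<open>F \<le> 0\<close>, \<open>\<lambda> F = 0\<close>.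

  (a) For \<open>(v, \<gamma>)\<close> in \<open>ker A1 \<inter> Delta3\<close> the function \<open>\<Psi> = \<langle>v, \<nabla>\<^sub>x f0\<rangle> + \<gamma> F\<close> has a derivative at
  \<open>(xbar, wbar)\<close> that depends on the increment of \<open>w\<close> only and is given by \<open>\<eta> = A2 (v, \<gamma>)\<close>. On the
  graph of \<open>S\<close> the system gives \<open>\<Psi> \<le> - \<lambda> \<langle>v, \<nabla>\<^sub>x F\<rangle>\<close>, whose positive part is of second order
  since \<open>\<lambda>\<close> is of first order and \<open>\<langle>v, \<nabla>\<^sub>x F\<rangle>\<close> is nonnegative at the base point.
  The Lipschitz-like property supplies points of the graph over \<open>wbar + t \<eta>\<close> at distance \<open>O(t)\<close>,
  which forces \<open>\<eta> = 0\<close>.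

  (b) The four kernel conditions make \<open>H = \<nabla>\<^sup>2\<^sub>x\<^sub>x f0\<close> invertible with \<open>\<langle>a, H\<inverse> a\<rangle> > 0\<close>,
  where \<open>a = \<nabla>\<^sub>x F\<close>. The linearized system \<open>H x + \<lambda> a = p\<close>, \<open>0 \<le> \<lambda>\<close>, \<open>\<langle>a, x\<rangle> \<le> q\<close>,
  \<open>\<lambda> (\<langle>a, x\<rangle> - q) = 0\<close> then has an explicit solution that is Lipschitz in \<open>(p, q)\<close>, and the
  stationary points near \<open>xbar\<close> are the fixed points of a contraction depending on \<open>w\<close> in a
  Lipschitz way (Robinson's strong regularity). This gives existence and the Lipschitz estimate at once,
  without coderivatives.
\<close>

subsection \<open>Second derivatives\<close>

text \<open>The mean value inequality, applied on a ball where \<open>f'\<close> stays within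
  \<open>e\<close> of \<open>f' x\<close>. Both points may vary near \<open>x\<close>, which
  differentiability at \<open>x\<close> alone would not allow; the symmetry of second derivatives
  and the contraction estimate rest on this.\<close>

lemma strict_derivative_estimate:
  fixes f :: "'a::real_normed_vector \<Rightarrow> 'b::real_normed_vector"
    and f' :: "'a \<Rightarrow> 'a \<Rightarrow>\<^sub>L 'b"
  assumes der: "\<And>z. (f has_derivative blinfun_apply (f' z)) (at z)"
    and cont: "isCont f' x" and e: "e > 0"
  obtains d where "d > 0"
    "\<And>y z. y \<in> ball x d \<Longrightarrow> z \<in> ball x d \<Longrightarrow> norm (f y - f z - f' x (y - z)) \<le> e * norm (y - z)"
proof -
  from cont e obtain d where d: "d > 0" "\<And>y. dist y x < d \<Longrightarrow> dist (f' y) (f' x) < e"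
    unfolding continuous_at_eps_delta by blast
  have "norm (f y - f z - f' x (y - z)) \<le> e * norm (y - z)"
    if "y \<in> ball x d" "z \<in> ball x d" for y z
  proof -
    have "norm (f y - f z - f' x (y - z)) \<le> norm (y - z) * e"
    proof (rule differentiable_bound_linearization[where S = "ball x d"])
      fix t :: real assume "t \<in> {0..1}"
      then have "(1 - t) *\<^sub>R z + t *\<^sub>R y \<in> ball x d"
        using that convexD_alt[OF convex_ball[of x d], of z y t] by auto
      then show "z + t *\<^sub>R (y - z) \<in> ball x d" by (simp add: algebra_simps)
    next
      fix u assume "u \<in> ball x d"
      show "(f has_derivative blinfun_apply (f' u)) (at u within ball x d)"
        using der by (rule has_derivative_at_withinI)
      have "norm (f' u - f' x) \<le> e"
        using d(2)[of u] \<open>u \<in> ball x d\<close> by (simp add: dist_commute dist_norm)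
      then show "onorm (blinfun_apply (f' u) - blinfun_apply (f' x)) \<le> e"
        by (simp add: norm_blinfun.rep_eq minus_blinfun.rep_eq fun_diff_def)
    qed (use d(1) in auto)
    then show ?thesis by (simp add: mult.commute)
  qed
  then show thesis using that d(1) by blast
qed

text \<open>The mean value theorem in direction \<open>h\<close> reduces the second difference to an
  increment of \<open>f'\<close> along \<open>t *\<^sub>R k\<close>, which the strict estimate for
  \<open>f'\<close> compares with \<open>f'' z\<close>.\<close>

lemma second_difference_estimate:
  fixes f :: "'a::real_normed_vector \<Rightarrow> real"
    and f' :: "'a \<Rightarrow> 'a \<Rightarrow>\<^sub>L real" and f'' :: "'a \<Rightarrow> 'a \<Rightarrow>\<^sub>L 'a \<Rightarrow>\<^sub>L real"
  assumes f': "\<And>z. (f has_derivative blinfun_apply (f' z)) (at z)"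
    and f'': "\<And>z. (f' has_derivative blinfun_apply (f'' z)) (at z)"
    and cont: "isCont f'' z" and e: "e > 0"
  shows "\<forall>\<^sub>F t in at_right 0.
    \<bar>f (z + t *\<^sub>R h + t *\<^sub>R k) - f (z + t *\<^sub>R h) - f (z + t *\<^sub>R k) + f z - t\<^sup>2 * f'' z k h\<bar>
      \<le> t\<^sup>2 * (e * norm h * norm k)"
proof -
  obtain d where d: "d > 0" "\<And>y y'. y \<in> ball z d \<Longrightarrow> y' \<in> ball z d \<Longrightarrow>
      norm (f' y - f' y' - f'' z (y - y')) \<le> e * norm (y - y')"
    using strict_derivative_estimate[OF f'' cont e] by blast
  \<comment> \<open>For \<open>t < r\<close> all points met below stay within \<open>d\<close> of
    \<open>z\<close>; the summand 1 keeps the denominator positive.\<close>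
  define r where "r = d / (norm h + norm k + 1)"
  have r: "r > 0" unfolding r_def using d(1) by (simp add: add_nonneg_pos)
  show ?thesis
  proof (rule eventually_at_rightI[of 0 r])
    show "0 < r" by (rule r)
    fix t assume t: "t \<in> {0<..<r}"
    then have td: "t * (norm h + norm k + 1) < d"
      using pos_less_divide_eq[of "norm h + norm k + 1" t d] unfolding r_def by (simp add: add_nonneg_pos)
    \<comment> \<open>The increment in direction \<open>k\<close> as a function of the position
      along \<open>h\<close>, so that \<open>\<psi> t - \<psi> 0\<close> is the second
      difference.\<close>
    define \<psi> where "\<psi> s = f (z + s *\<^sub>R h + t *\<^sub>R k) - f (z + s *\<^sub>R h)" for s
    have der: "(\<psi> has_real_derivative (f' (z + s *\<^sub>R h + t *\<^sub>R k) h - f' (z + s *\<^sub>R h) h)) (at s)" for s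
    proof -
      have 1: "((\<lambda>s. f (z + s *\<^sub>R h + c)) has_derivative (\<lambda>u. f' (z + s *\<^sub>R h + c) (u *\<^sub>R h))) (at s)" for c
      proof -
        have "((\<lambda>s. z + s *\<^sub>R h + c) has_derivative (\<lambda>u. u *\<^sub>R h)) (at s)"
          by (auto intro!: derivative_eq_intros)
        from diff_chain_at[OF this f'] show ?thesis by (simp add: o_def)
      qed
      have "(\<psi> has_derivative (\<lambda>u. f' (z + s *\<^sub>R h + t *\<^sub>R k) (u *\<^sub>R h) - f' (z + s *\<^sub>R h) (u *\<^sub>R h))) (at s)"
        unfolding \<psi>_def using has_derivative_diff[OF 1[of "t *\<^sub>R k"] 1[of 0]] by simp
      then show ?thesis
        unfolding has_field_derivative_def
        by (rule has_derivative_eq_rhs) (simp add: fun_eq_iff blinfun.scaleR_right algebra_simps)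
    qed
    obtain s where s: "0 < s" "s < t" "\<psi> t - \<psi> 0 = (t - 0) * (f' (z + s *\<^sub>R h + t *\<^sub>R k) h - f' (z + s *\<^sub>R h) h)"
      using MVT2[of 0 t \<psi>, OF _ der] t by auto
    have bnd: "norm (s *\<^sub>R h + c *\<^sub>R t *\<^sub>R k) < d" if "c \<in> {0,1}" for c
    proof -
      have "norm (s *\<^sub>R h + c *\<^sub>R t *\<^sub>R k) \<le> s * norm h + t * norm k"
        using that s t norm_triangle_ineq[of "s *\<^sub>R h" "c *\<^sub>R t *\<^sub>R k"] by auto
      also have "\<dots> \<le> t * norm h + t * norm k"
        using s by (simp add: mult_right_mono)
      also have "\<dots> < d" using td t by (simp add: algebra_simps)
      finally show ?thesis .
    qed
    have "norm (f' (z + s *\<^sub>R h + t *\<^sub>R k) - f' (z + s *\<^sub>R h) - f'' z (t *\<^sub>R k)) \<le> e * norm (t *\<^sub>R k)"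
    proof -
      have "z + s *\<^sub>R h + t *\<^sub>R k \<in> ball z d" "z + s *\<^sub>R h \<in> ball z d"
        using bnd[of 0] bnd[of 1] by (simp_all add: dist_norm norm_minus_commute add.assoc algebra_simps)
      from d(2)[OF this] show ?thesis by simp
    qed
    then have "norm ((f' (z + s *\<^sub>R h + t *\<^sub>R k) - f' (z + s *\<^sub>R h) - f'' z (t *\<^sub>R k)) h) \<le> e * norm (t *\<^sub>R k) * norm h"
      by (rule order.trans[OF norm_blinfun mult_right_mono]) simp
    then have *: "\<bar>f' (z + s *\<^sub>R h + t *\<^sub>R k) h - f' (z + s *\<^sub>R h) h - t * f'' z k h\<bar> \<le> t * (e * norm h * norm k)"
      using t by (simp add: blinfun.diff_left blinfun.scaleR_left blinfun.scaleR_right mult_ac)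
    have "\<bar>\<psi> t - \<psi> 0 - t\<^sup>2 * f'' z k h\<bar> = t * \<bar>f' (z + s *\<^sub>R h + t *\<^sub>R k) h - f' (z + s *\<^sub>R h) h - t * f'' z k h\<bar>"
    proof -
      have "\<psi> t - \<psi> 0 - t\<^sup>2 * f'' z k h = t * (f' (z + s *\<^sub>R h + t *\<^sub>R k) h - f' (z + s *\<^sub>R h) h - t * f'' z k h)"
        unfolding s(3) by (simp add: algebra_simps power2_eq_square)
      then show ?thesis using t by (simp add: abs_mult)
    qed
    also have "\<dots> \<le> t * (t * (e * norm h * norm k))"
      using * t by (intro mult_left_mono) auto
    finally show "\<bar>f (z + t *\<^sub>R h + t *\<^sub>R k) - f (z + t *\<^sub>R h) - f (z + t *\<^sub>R k) + f z - t\<^sup>2 * f'' z k h\<bar>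
      \<le> t\<^sup>2 * (e * norm h * norm k)"
      by (simp add: \<psi>_def power2_eq_square algebra_simps)
  qed
qed

text \<open>The second difference does not change when \<open>h\<close> and \<open>k\<close> are
  swapped, so after division by \<open>t\<^sup>2\<close> both values approximate the same
  number.\<close>

lemma second_derivative_symmetric:
  fixes f :: "'a::real_normed_vector \<Rightarrow> real"
    and f' :: "'a \<Rightarrow> 'a \<Rightarrow>\<^sub>L real" and f'' :: "'a \<Rightarrow> 'a \<Rightarrow>\<^sub>L 'a \<Rightarrow>\<^sub>L real"
  assumes f': "\<And>z. (f has_derivative blinfun_apply (f' z)) (at z)"
    and f'': "\<And>z. (f' has_derivative blinfun_apply (f'' z)) (at z)"
    and cont: "isCont f'' z"
  shows "f'' z h k = f'' z k h"
proof -
  have "\<bar>f'' z h k - f'' z k h\<bar> \<le> e" if e: "e > 0" for e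
  proof -
    define c where "c = e / (2 * (norm h * norm k + 1))"
    have hk: "0 < norm h * norm k + 1" by (simp add: add_nonneg_pos)
    have c: "c > 0" unfolding c_def using e hk by simp
    let ?\<Delta> = "\<lambda>t. f (z + t *\<^sub>R h + t *\<^sub>R k) - f (z + t *\<^sub>R h) - f (z + t *\<^sub>R k) + f z"
    have "\<forall>\<^sub>F t in at_right 0. \<bar>?\<Delta> t - t\<^sup>2 * f'' z k h\<bar> \<le> t\<^sup>2 * (c * norm h * norm k)
        \<and> \<bar>?\<Delta> t - t\<^sup>2 * f'' z h k\<bar> \<le> t\<^sup>2 * (c * norm h * norm k) \<and> t > 0"
      using second_difference_estimate[OF f' f'' cont c, of h k]
        second_difference_estimate[OF f' f'' cont c, of k h]
        eventually_at_right_less[of "0::real"]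
      by eventually_elim (auto simp: algebra_simps)
    then obtain t where t: "\<bar>?\<Delta> t - t\<^sup>2 * f'' z k h\<bar> \<le> t\<^sup>2 * (c * norm h * norm k)"
        "\<bar>?\<Delta> t - t\<^sup>2 * f'' z h k\<bar> \<le> t\<^sup>2 * (c * norm h * norm k)" "t > 0"
      using eventually_happens'[of "at_right (0::real)"] by fastforce
    have "t\<^sup>2 * \<bar>f'' z h k - f'' z k h\<bar> = \<bar>t\<^sup>2 * f'' z h k - t\<^sup>2 * f'' z k h\<bar>"
      by (simp add: abs_mult flip: right_diff_distrib)
    also have "\<dots> \<le> t\<^sup>2 * (2 * (c * norm h * norm k))"
      using t(1,2) by linarith
    finally have "\<bar>f'' z h k - f'' z k h\<bar> \<le> 2 * (c * norm h * norm k)"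
      using t(3) by simp
    also have "\<dots> \<le> 2 * c * (norm h * norm k + 1)" using c by (simp add: algebra_simps)
    also have "\<dots> = e" unfolding c_def using hk by (simp add: field_simps)
    finally show ?thesis .
  qed
  from field_le_epsilon[of "\<bar>f'' z h k - f'' z k h\<bar>" 0] this show ?thesis by simp
qed

section \<open>Gradients, partial derivatives and Hessian blocks\<close>

lemma inner_sum_Basis_linear:
  fixes D :: "'a::euclidean_space \<Rightarrow> real"
  assumes "bounded_linear D"
  shows "inner (\<Sum>b\<in>Basis. D b *\<^sub>R b) h = D h"
proof -
  interpret D: bounded_linear D by (rule assms)
  have "D h = D (\<Sum>b\<in>Basis. inner h b *\<^sub>R b)" by (simp add: euclidean_representation)
  also have "\<dots> = (\<Sum>b\<in>Basis. inner h b * D b)" by (simp add: D.sum D.scaleR)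
  also have "\<dots> = (\<Sum>b\<in>Basis. D b * inner b h)"
    by (intro sum.cong refl) (simp only: inner_commute[of h] mult.commute)
  finally show ?thesis by (simp add: inner_sum_left)
qed

text \<open>The coordinate formula resolves the definite description in \<open>gradient\<close> and
  shows that the gradient depends linearly on the derivative.\<close>

lemma gradient_eq:
  fixes f :: "'a::euclidean_space \<Rightarrow> real"
  assumes "(f has_derivative D) (at x)"
  shows "gradient f x = (\<Sum>b\<in>Basis. D b *\<^sub>R b)"
  unfolding gradient_def
proof (rule the_equality)
  note * = inner_sum_Basis_linear[OF has_derivative_bounded_linear[OF assms]]
  show "GDERIV f x :> (\<Sum>b\<in>Basis. D b *\<^sub>R b)"
    using assms unfolding gderiv_def inner_commute[of _ "\<Sum>b\<in>Basis. D b *\<^sub>R b"] * .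
  fix E assume "GDERIV f x :> E"
  then have "(\<lambda>h. inner h E) = D"
    unfolding gderiv_def using assms by (rule has_derivative_unique)
  then have "inner E h = inner (\<Sum>b\<in>Basis. D b *\<^sub>R b) h" for h
    unfolding * using inner_commute[of E h] by (metis (full_types))
  then show "E = (\<Sum>b\<in>Basis. D b *\<^sub>R b)"
    using vector_eq_ldot[of E "\<Sum>b\<in>Basis. D b *\<^sub>R b"] by (metis inner_commute)
qed

lemma inner_gradient:
  fixes f :: "'a::euclidean_space \<Rightarrow> real"
  assumes "(f has_derivative D) (at x)"
  shows "inner (gradient f x) h = D h"
  unfolding gradient_eq[OF assms]
  by (rule inner_sum_Basis_linear[OF has_derivative_bounded_linear[OF assms]])

lemma has_derivative_fst_section:
  assumes "(f has_derivative D) (at (x, w))"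
  shows "((\<lambda>y. f (y, w)) has_derivative (\<lambda>h. D (h, 0))) (at x)"
proof -
  have "((\<lambda>y. (y, w)) has_derivative (\<lambda>h. (h, 0))) (at x)"
    by (auto intro!: derivative_eq_intros)
  from diff_chain_at[OF this assms] show ?thesis by (simp add: o_def)
qed

lemma has_derivative_snd_section:
  assumes "(f has_derivative D) (at (x, w))"
  shows "((\<lambda>u. f (x, u)) has_derivative (\<lambda>h. D (0, h))) (at w)"
proof -
  have "((\<lambda>u. (x, u)) has_derivative (\<lambda>h. (0, h))) (at w)"
    by (auto intro!: derivative_eq_intros)
  from diff_chain_at[OF this assms] show ?thesis by (simp add: o_def)
qed

lemma inner_grad_x:
  assumes "(f has_derivative D) (at (x, w))"
  shows "inner (grad_x f x w) h = D (h, 0)"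
  unfolding grad_x_def by (rule inner_gradient[OF has_derivative_fst_section[OF assms]])

lemma inner_grad_w:
  assumes "(f has_derivative D) (at (x, w))"
  shows "inner (grad_w f x w) h = D (0, h)"
  unfolding grad_w_def by (rule inner_gradient[OF has_derivative_snd_section[OF assms]])

lemma jacobian_eq:
  fixes f :: "real^'a \<Rightarrow> real^'b"
  assumes "(f has_derivative D) (at x)"
  shows "jacobian f (at x) *v h = D h"
proof -
  have "f differentiable at x" using assms by (rule differentiableI)
  then have "(f has_derivative (\<lambda>h. jacobian f (at x) *v h)) (at x)"
    by (rule jacobian_works[THEN iffD1])
  from has_derivative_unique[OF this assms] show ?thesis by (simp add: fun_eq_iff)
qed

text \<open>Links the matrix notions to continuous derivatives given as bounded linear maps; it is
  interpreted for both \<open>f0\<close> and \<open>F\<close>. \<open>g'\<close> is the derivative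
  of the x-gradient in both variables jointly, and its restrictions to the two factors are the
  Hessian blocks. The mixed block appears under an inner product because \<open>hess_wx\<close> is a
  transposed Jacobian.\<close>

locale second_order_data =
  fixes f :: "(real^'n) \<times> (real^'d) \<Rightarrow> real"
    and f' :: "(real^'n) \<times> (real^'d) \<Rightarrow> ((real^'n) \<times> (real^'d)) \<Rightarrow>\<^sub>L real"
    and g' :: "(real^'n) \<times> (real^'d) \<Rightarrow> ((real^'n) \<times> (real^'d)) \<Rightarrow>\<^sub>L (real^'n)"
  assumes deriv: "(f has_derivative blinfun_apply (f' z)) (at z)"
    and isCont_deriv: "isCont f' z"
    and deriv_pair: "f' (x, w) (h, k) = inner (grad_x f x w) h + inner (grad_w f x w) k"
    and grad_deriv: "((\<lambda>z. grad_x f (fst z) (snd z)) has_derivative blinfun_apply (g' z)) (at z)"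
    and isCont_grad_deriv: "isCont g' z"
    and grad_deriv_x: "g' (x, w) (h, 0) = hess_xx f x w *v h"
    and inner_grad_deriv_w: "inner v (g' (x, w) (0, k)) = inner (hess_wx f x w *v v) k"
    and hess_xx_symmetric: "inner (hess_xx f x w *v h) u = inner h (hess_xx f x w *v u)"

lemma twice_continuously_differentiable_second_order_data:
  fixes f :: "(real^'n) \<times> (real^'d) \<Rightarrow> real"
  assumes "twice_continuously_differentiable f"
  shows "\<exists>f' g'. second_order_data f f' g'"
proof -
  obtain f' f'' where f': "\<And>z. (f has_derivative blinfun_apply (f' z)) (at z)"
    and f'': "\<And>z. (f' has_derivative blinfun_apply (f'' z)) (at z)" and c: "continuous_on UNIV f''"
    using assms unfolding twice_continuously_differentiable_def by blast
  have c'': "isCont f'' z" for z using c continuous_on_eq_continuous_at[of UNIV f''] by blast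
  have c': "isCont f' z" for z using f'' by (rule has_derivative_continuous)
  \<comment> \<open>The Riesz representative of a functional restricted to x-directions. It is
    bounded and linear in the functional, so the x-gradient, being \<open>L\<close> applied to
    \<open>f'\<close>, inherits a continuous derivative from \<open>f''\<close>.\<close>
  define L :: "(((real^'n) \<times> (real^'d)) \<Rightarrow>\<^sub>L real) \<Rightarrow>\<^sub>L (real^'n)"
    where "L = Blinfun (\<lambda>\<phi>. \<Sum>b\<in>Basis. blinfun_apply \<phi> (b, 0) *\<^sub>R b)"
  have bl: "bounded_linear (\<lambda>\<phi>. \<Sum>b\<in>(Basis::(real^'n) set). blinfun_apply \<phi> (b, 0::real^'d) *\<^sub>R b)"
    by (intro bounded_linear_intros)
  have L: "L \<phi> = (\<Sum>b\<in>Basis. \<phi> (b, 0) *\<^sub>R b)" for \<phi>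
    unfolding L_def by (simp add: bounded_linear_Blinfun_apply[OF bl])
  have gL: "grad_x f x w = L (f' (x, w))" for x w
    unfolding grad_x_def L by (rule gradient_eq[OF has_derivative_fst_section[OF f']])
  define g' where "g' z = L o\<^sub>L f'' z" for z
  have g'd: "((\<lambda>z. grad_x f (fst z) (snd z)) has_derivative blinfun_apply (g' z)) (at z)" for z
  proof -
    have "blinfun_apply (g' z) = (\<lambda>h. L (f'' z h))" by (simp add: g'_def fun_eq_iff)
    then show ?thesis
      using bounded_linear.has_derivative[OF blinfun.bounded_linear_right f'', of L z] by (simp add: gL)
  qed
  have g'c: "isCont g' z" for z
    unfolding g'_def by (intro continuous_intros c'')
  have ing: "inner v (g' z u) = f'' z u (v, 0)" for v z u
  proof -
    have eq: "inner v (L \<phi>) = \<phi> (v, 0)" for \<phi>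
    proof -
      have "bounded_linear (\<lambda>h. \<phi> (h, 0))" by (intro bounded_linear_intros)
      from inner_sum_Basis_linear[OF this] show ?thesis
        unfolding L inner_commute[of v] .
    qed
    show ?thesis by (simp add: g'_def eq)
  qed
  have hxx: "g' (x, w) (h, 0) = hess_xx f x w *v h" for x w h
    unfolding hess_xx_def
    using jacobian_eq[OF has_derivative_fst_section[OF g'd[of "(x, w)"]]] by simp
  have hwx: "inner v (g' (x, w) (0, k)) = inner (hess_wx f x w *v v) k" for x w v k
  proof -
    have "jacobian (\<lambda>u. grad_x f x u) (at w) *v k = g' (x, w) (0, k)"
      using jacobian_eq[OF has_derivative_snd_section[OF g'd[of "(x, w)"]]] by simp
    then show ?thesis
      by (simp add: hess_wx_def dot_lmul_matrix flip: vector_transpose_matrix)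
  qed
  have sym: "inner (hess_xx f x w *v h) k = inner h (hess_xx f x w *v k)" for x w h k
  proof -
    have "inner (hess_xx f x w *v h) k = inner k (g' (x, w) (h, 0))"
      unfolding hxx by (rule inner_commute)
    also have "\<dots> = f'' (x, w) (h, 0) (k, 0)" by (rule ing)
    also have "\<dots> = f'' (x, w) (k, 0) (h, 0)" by (rule second_derivative_symmetric[OF f' f'' c''])
    also have "\<dots> = inner h (g' (x, w) (k, 0))" by (rule ing[symmetric])
    finally show ?thesis unfolding hxx .
  qed
  have pair: "f' (x, w) (h, k) = inner (grad_x f x w) h + inner (grad_w f x w) k" for x w h k
    unfolding inner_grad_x[OF f'] inner_grad_w[OF f'] by (simp flip: blinfun.add_right)
  have "second_order_data f f' g'"
    by (rule second_order_data.intro; fact f' c' pair g'd g'c hxx hwx sym)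
  then show ?thesis by blast
qed

subsection \<open>Normal cones of sublevel sets\<close>

text \<open>Clearing the denominator replaces the extended-real upper limit by an epsilon condition;
  at isolated points the filter is trivial and both sides hold.\<close>

lemma frechet_normal_cone_iff:
  "p \<in> frechet_normal_cone \<Omega> y \<longleftrightarrow>
     y \<in> \<Omega> \<and> (\<forall>e>0. \<forall>\<^sub>F v in at y within \<Omega>. inner p (v - y) \<le> e * norm (v - y))"
proof -
  have "Limsup (at y within \<Omega>) (\<lambda>v. ereal (inner p (v - y) / norm (v - y))) \<le> 0 \<longleftrightarrow>
      (\<forall>e>0. \<forall>\<^sub>F v in at y within \<Omega>. inner p (v - y) \<le> e * norm (v - y))"
    (is "?L \<longleftrightarrow> ?R")
  proof
    assume L: ?L
    show ?R
    proof (intro allI impI)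
      fix e :: real assume "e > 0"
      then have "\<forall>\<^sub>F v in at y within \<Omega>. ereal (inner p (v - y) / norm (v - y)) < ereal e"
        using L[unfolded Limsup_le_iff, rule_format, of "ereal e"] by simp
      then show "\<forall>\<^sub>F v in at y within \<Omega>. inner p (v - y) \<le> e * norm (v - y)"
      proof eventually_elim
        case (elim v)
        then show ?case
          by (cases "v = y") (simp_all add: divide_less_eq)
      qed
    qed
  next
    assume R: ?R
    show ?L
      unfolding Limsup_le_iff
    proof (intro allI impI)
      fix c :: ereal assume "c > 0"
      then obtain e where e: "0 < e" "ereal e < c" using ereal_dense2[of 0 c] by auto
      have "\<forall>\<^sub>F v in at y within \<Omega>. inner p (v - y) \<le> e * norm (v - y)" using R e(1) by blast
      moreover have "\<forall>\<^sub>F v in at y within \<Omega>. v \<noteq> y"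
        by (simp add: eventually_at_filter)
      ultimately show "\<forall>\<^sub>F v in at y within \<Omega>. ereal (inner p (v - y) / norm (v - y)) < c"
      proof eventually_elim
        case (elim v)
        then have "inner p (v - y) / norm (v - y) \<le> e" by (simp add: divide_le_eq)
        then show ?case using e(2) by (meson ereal_less_eq(3) order_le_less_trans)
      qed
    qed
  qed
  then show ?thesis by (simp add: frechet_normal_cone_def)
qed

text \<open>Along a feasible ray the defining inequality is homogeneous in \<open>t\<close>, so
  dividing by \<open>t\<close> leaves a bound by an arbitrarily small number.\<close>

lemma frechet_normal_inner_direction:
  assumes p: "p \<in> frechet_normal_cone \<Omega> y"
    and feas: "\<forall>\<^sub>F t in at_right 0. y + t *\<^sub>R d \<in> \<Omega>"
  shows "inner p d \<le> 0"
proof (cases "d = 0")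
  case False
  have lim: "filterlim (\<lambda>t. y + t *\<^sub>R d) (at y within \<Omega>) (at_right 0)"
    unfolding filterlim_at
  proof
    show "\<forall>\<^sub>F t in at_right 0. y + t *\<^sub>R d \<in> \<Omega> \<and> y + t *\<^sub>R d \<noteq> y"
      using feas eventually_at_right_less[of "0::real"] by eventually_elim (use False in auto)
    have "((\<lambda>t. y + t *\<^sub>R d) \<longlongrightarrow> y + 0 *\<^sub>R d) (at_right 0)" by (intro tendsto_intros)
    then show "((\<lambda>t. y + t *\<^sub>R d) \<longlongrightarrow> y) (at_right 0)" by simp
  qed
  have "inner p d \<le> 0 + e" if "e > 0" for e
  proof -
    have c: "e / norm d > 0" using that False by simp
    have "\<forall>\<^sub>F t in at_right 0. inner p (t *\<^sub>R d) \<le> e / norm d * norm (t *\<^sub>R d) \<and> t > 0"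
      using filterlim_iff[THEN iffD1, OF lim, rule_format, OF p[unfolded frechet_normal_cone_iff, THEN conjunct2, rule_format, OF c]]
        eventually_at_right_less[of "0::real"]
      by eventually_elim simp
    then obtain t where "inner p (t *\<^sub>R d) \<le> e / norm d * norm (t *\<^sub>R d)" "t > 0"
      using eventually_happens'[of "at_right (0::real)"] by fastforce
    then show ?thesis using False by (simp add: mult.commute)
  qed
  then show ?thesis by (rule field_le_epsilon)
qed simp

text \<open>Every direction is feasible where \<open>F y < 0\<close>, and every strict descent
  direction is feasible on the boundary. In the first case testing with \<open>p\<close> itself
  gives \<open>p = 0\<close>; in the second, \<open>p\<close> is polar to an open half-space, so its
  component \<open>q\<close> orthogonal to \<open>a\<close> must vanish.\<close>

lemma frechet_normal_sublevel:
  fixes F :: "'a::real_inner \<Rightarrow> real"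
  assumes der: "(F has_derivative (\<lambda>h. inner a h)) (at y)" and a: "a \<noteq> 0"
    and p: "p \<in> frechet_normal_cone {x. F x \<le> 0} y"
  shows "\<exists>l\<ge>0. p = l *\<^sub>R a \<and> l * F y = 0"
proof -
  have Fy: "F y \<le> 0" using p by (simp add: frechet_normal_cone_iff)
  have dir: "inner p d \<le> 0" if "F y < 0 \<or> inner a d < 0" for d
  proof (rule frechet_normal_inner_direction[OF p])
    have der': "((\<lambda>t. F (y + t *\<^sub>R d)) has_real_derivative inner a d) (at 0)"
    proof -
      have 1: "((\<lambda>t. y + t *\<^sub>R d) has_derivative (\<lambda>t. t *\<^sub>R d)) (at 0)"
        by (auto intro!: derivative_eq_intros)
      have "(F has_derivative (\<lambda>h. inner a h)) (at (y + 0 *\<^sub>R d))" using der by simp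
      from diff_chain_at[OF 1 this] have "((\<lambda>t. F (y + t *\<^sub>R d)) has_derivative (\<lambda>t. t * inner a d)) (at 0)"
        by (simp add: o_def)
      then show ?thesis
        unfolding has_field_derivative_def by (rule has_derivative_eq_rhs) (simp add: fun_eq_iff)
    qed
    show "\<forall>\<^sub>F t in at_right 0. y + t *\<^sub>R d \<in> {x. F x \<le> 0}"
      using that
    proof
      assume "F y < 0"
      have "((\<lambda>t. F (y + t *\<^sub>R d)) \<longlongrightarrow> F y) (at_right 0)"
        using DERIV_isCont[OF der'] by (simp add: isCont_def filterlim_at_split)
      from order_tendstoD(2)[OF this \<open>F y < 0\<close>] show ?thesis
        by eventually_elim simp
    next
      assume "inner a d < 0"
      from DERIV_neg_dec_right[OF der' this] obtain r
        where "r > 0" "\<forall>h>0. h < r \<longrightarrow> F (y + h *\<^sub>R d) < F y" by auto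
      then show ?thesis using Fy
        by (intro eventually_at_rightI[of 0 r]) force+
    qed
  qed
  show ?thesis
  proof (cases "F y < 0")
    case True
    then have "inner p p \<le> 0" using dir by blast
    then have "p = 0" by (metis inner_gt_zero_iff not_less)
    then show ?thesis by (intro exI[of _ 0]) simp
  next
    case False
    then have F0: "F y = 0" using Fy by simp
    define l where "l = inner p a / inner a a"
    define q where "q = p - l *\<^sub>R a"
    have aa: "inner a a > 0" using a by simp
    have qa: "inner q a = 0" unfolding q_def l_def using aa by (simp add: inner_diff_left)
    have "inner q q \<le> 0 + e" if e: "e > 0" for e
    proof -
      \<comment> \<open>\<open>q\<close> is merely tangential, so it is tilted by
        \<open>- c *\<^sub>R a\<close> into a strict descent direction; this \<open>c\<close> keeps
        the resulting error \<open>c * inner p a\<close> below \<open>e\<close>.\<close>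
      define c where "c = e / (\<bar>inner p a\<bar> + 1)"
      have c: "c > 0" unfolding c_def using e by simp
      have "inner a (q - c *\<^sub>R a) < 0"
        using qa aa c by (simp add: inner_diff_right inner_commute)
      then have "inner p (q - c *\<^sub>R a) \<le> 0" using dir by blast
      moreover have "inner p q = inner q q"
        using qa by (simp add: q_def inner_diff_left inner_diff_right inner_commute)
      ultimately have "inner q q \<le> c * inner p a" by (simp add: inner_diff_right)
      also have "\<dots> \<le> c * (\<bar>inner p a\<bar> + 1)" using c by (intro mult_left_mono) auto
      also have "\<dots> = e" unfolding c_def by simp
      finally show ?thesis by simp
    qed
    then have "inner q q \<le> 0" by (rule field_le_epsilon)
    then have "q = 0" by (metis inner_gt_zero_iff not_less)
    then have "p = l *\<^sub>R a" by (simp add: q_def)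
    moreover have "inner p (- a) \<le> 0" using dir[of "- a"] aa by simp
    then have "l \<ge> 0" unfolding l_def using aa by (simp add: divide_nonneg_pos)
    ultimately show ?thesis using F0 by auto
  qed
qed

lemma limiting_normal_sublevel_iff:
  fixes F :: "'a::real_inner \<Rightarrow> real"
  assumes der: "\<And>y. (F has_derivative (\<lambda>h. inner (A y) h)) (at y)"
    and cont: "isCont A x" and a: "A x \<noteq> 0"
  shows "p \<in> limiting_normal_cone {x. F x \<le> 0} x \<longleftrightarrow>
    F x \<le> 0 \<and> (\<exists>l\<ge>0. p = l *\<^sub>R A x \<and> l * F x = 0)"
proof
  assume "p \<in> limiting_normal_cone {x. F x \<le> 0} x"
  then obtain v q where Fx: "F x \<le> 0" and v: "v \<longlonglongrightarrow> x" and q: "q \<longlonglongrightarrow> p"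
    and N: "\<And>k. q k \<in> frechet_normal_cone {x. F x \<le> 0} (v k)"
    by (auto simp: limiting_normal_cone_def split: if_splits)
  have Av: "(\<lambda>k. A (v k)) \<longlonglongrightarrow> A x" by (rule isCont_tendsto_compose[OF cont v])
  have Fv: "(\<lambda>k. F (v k)) \<longlonglongrightarrow> F x"
    by (rule isCont_tendsto_compose[OF has_derivative_continuous[OF der] v])
  \<comment> \<open>Projection onto \<open>A (v k)\<close> expresses the multiplier as a continuous
    function of \<open>q k\<close> and \<open>A (v k)\<close>. Hence the multipliers converge, and
    sign, direction and complementarity pass to the limit.\<close>
  define l where "l k = inner (q k) (A (v k)) / inner (A (v k)) (A (v k))" for k
  define m where "m = inner p (A x) / inner (A x) (A x)"
  have lm: "l \<longlonglongrightarrow> m"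
    unfolding l_def m_def using a by (intro tendsto_intros q Av) auto
  have "\<forall>\<^sub>F k in sequentially. A (v k) \<noteq> 0"
    using Av a by (rule tendsto_imp_eventually_ne)
  then have ev: "\<forall>\<^sub>F k in sequentially. l k \<ge> 0 \<and> q k = l k *\<^sub>R A (v k) \<and> l k * F (v k) = 0"
  proof eventually_elim
    case (elim k)
    then obtain c where "c \<ge> 0" "q k = c *\<^sub>R A (v k)" "c * F (v k) = 0"
      using frechet_normal_sublevel[OF der elim N] by blast
    moreover have "l k = c" unfolding l_def using elim by (simp add: calculation)
    ultimately show ?case by simp
  qed
  have "m \<ge> 0"
    by (rule tendsto_lowerbound[OF lm eventually_mono[OF ev]]) auto
  moreover have "p = m *\<^sub>R A x"
    by (rule LIMSEQ_unique[OF q], rule Lim_transform_eventually[OF tendsto_scaleR[OF lm Av]], rule eventually_mono[OF ev]) auto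
  moreover have "m * F x = 0"
    by (rule LIMSEQ_unique[OF tendsto_mult[OF lm Fv]], rule tendsto_eventually, rule eventually_mono[OF ev]) auto
  ultimately show "F x \<le> 0 \<and> (\<exists>l\<ge>0. p = l *\<^sub>R A x \<and> l * F x = 0)" using Fx by blast
next
  assume "F x \<le> 0 \<and> (\<exists>l\<ge>0. p = l *\<^sub>R A x \<and> l * F x = 0)"
  then obtain l where Fx: "F x \<le> 0" and l: "l \<ge> 0" "p = l *\<^sub>R A x" "l * F x = 0" by blast
  \<comment> \<open>For the converse \<open>p\<close> is already a Frechet normal at
    \<open>x\<close>, so constant sequences suffice.\<close>
  have "p \<in> frechet_normal_cone {x. F x \<le> 0} x"
    unfolding frechet_normal_cone_iff
  proof (intro conjI allI impI)
    show "x \<in> {x. F x \<le> 0}" using Fx by simp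
    fix e :: real assume e: "e > 0"
    \<comment> \<open>Gives \<open>l * c \<le> e\<close> also when \<open>l = 0\<close>.\<close>
    define c where "c = e / (l + 1)"
    have c: "c > 0" unfolding c_def using e l(1) by simp
    obtain r where r: "r > 0" "\<And>y. norm (y - x) < r \<Longrightarrow> \<bar>F y - F x - inner (A x) (y - x)\<bar> \<le> c * norm (y - x)"
      using der[of x] c unfolding has_derivative_at_alt by (metis real_norm_def)
    show "\<forall>\<^sub>F v in at x within {x. F x \<le> 0}. inner p (v - x) \<le> e * norm (v - x)"
      unfolding eventually_at
    proof (intro exI[of _ r] conjI ballI impI)
      fix v assume v: "v \<in> {x. F x \<le> 0}" "v \<noteq> x \<and> dist v x < r"
      then have "inner (A x) (v - x) \<le> F v - F x + c * norm (v - x)"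
        using r(2)[of v] by (simp add: dist_norm)
      then have "l * inner (A x) (v - x) \<le> l * (F v - F x + c * norm (v - x))"
        using l(1) by (intro mult_left_mono)
      also have "\<dots> = l * F v + (l * c) * norm (v - x)"
        using l(3) by (simp add: algebra_simps)
      also have "\<dots> \<le> 0 + e * norm (v - x)"
      proof (intro add_mono mult_right_mono)
        show "l * F v \<le> 0" using l(1) v(1) by (simp add: mult_nonneg_nonpos)
        have "l * c \<le> (l + 1) * c" using c by simp
        also have "\<dots> = e" unfolding c_def using l(1) by simp
        finally show "l * c \<le> e" .
      qed simp
      finally show "inner p (v - x) \<le> e * norm (v - x)" using l(2) by simp
    qed (use r in simp)
  qed
  then show "p \<in> limiting_normal_cone {x. F x \<le> 0} x"
    using Fx unfolding limiting_normal_cone_def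
    by (simp, intro exI[of _ "\<lambda>_. x"] conjI exI[of _ "\<lambda>_. p"]) simp_all
qed

subsection \<open>Parametrized contractions and linear complementarity\<close>

text \<open>Banach's fixed point theorem yields a fixed point for \<open>w\<close>. Comparing it
  with any given fixed point \<open>z'\<close> for \<open>w'\<close>, half of the distance is
  absorbed on the left, which gives the constant \<open>2 * L\<close>.\<close>

lemma parametrized_contraction:
  fixes T :: "'w::real_normed_vector \<Rightarrow> 'z::banach \<Rightarrow> 'z"
  assumes fix0: "T w0 z0 = z0" and r: "r > 0" and s: "s > 0" and L: "L \<ge> 0"
    and est: "\<And>w w' z z'. w \<in> ball w0 s \<Longrightarrow> w' \<in> ball w0 s \<Longrightarrow> z \<in> cball z0 r \<Longrightarrow> z' \<in> cball z0 r \<Longrightarrow>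
      norm (T w z - T w' z') \<le> 1/2 * norm (z - z') + L * norm (w - w')"
  obtains \<rho> where "\<rho> > 0" "\<rho> \<le> s"
    "\<And>w w' z'. w \<in> ball w0 \<rho> \<Longrightarrow> w' \<in> ball w0 \<rho> \<Longrightarrow> z' \<in> cball z0 r \<Longrightarrow> T w' z' = z' \<Longrightarrow>
      \<exists>z\<in>cball z0 r. T w z = z \<and> norm (z - z') \<le> 2 * L * norm (w - w')"
proof
  \<comment> \<open>Moving the parameter from \<open>w0\<close> to \<open>w\<close> then shifts
    values by at most \<open>r / 2\<close>, so \<open>T w\<close> maps the ball into itself;
    \<open>L + 1\<close> avoids a zero denominator.\<close>
  define \<rho> where "\<rho> = min s (r / (2 * (L + 1)))"
  show "\<rho> > 0" "\<rho> \<le> s" unfolding \<rho>_def using r s L by auto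
  fix w w' z' assume w: "w \<in> ball w0 \<rho>" "w' \<in> ball w0 \<rho>" and z': "z' \<in> cball z0 r" "T w' z' = z'"
  have ws: "w \<in> ball w0 s" "w' \<in> ball w0 s" "w0 \<in> ball w0 s" using w \<open>\<rho> \<le> s\<close> s by auto
  have self: "T w ` cball z0 r \<subseteq> cball z0 r"
  proof (rule image_subsetI)
    fix z assume z: "z \<in> cball z0 r"
    have "norm (T w z - T w0 z0) \<le> 1/2 * norm (z - z0) + L * norm (w - w0)"
      using est[OF ws(1,3) z] r by simp
    also have "\<dots> \<le> 1/2 * r + L * (r / (2 * (L + 1)))"
      using z w L by (intro add_mono mult_left_mono) (auto simp: \<rho>_def dist_norm norm_minus_commute)
    also have "\<dots> \<le> 1/2 * r + (L + 1) * (r / (2 * (L + 1)))"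
      using r L by (intro add_left_mono mult_right_mono) auto
    also have "(L + 1) * (r / (2 * (L + 1))) = r / 2" using L by (simp add: field_simps)
    also have "1/2 * r + r / 2 = r" by simp
    finally show "T w z \<in> cball z0 r" by (simp add: fix0 dist_norm norm_minus_commute)
  qed
  have "\<exists>!z. z \<in> cball z0 r \<and> T w z = z"
  proof (rule Banach_fix[where c = "1/2"])
    show "complete (cball z0 r)" by (simp add: complete_eq_closed)
    show "cball z0 r \<noteq> {}" using r by simp
    show "dist (T w z) (T w y) \<le> 1/2 * dist z y" if "z \<in> cball z0 r" "y \<in> cball z0 r" for z y
      using est[OF ws(1,1) that] by (simp add: dist_norm)
  qed (use self in auto)
  then obtain z where z: "z \<in> cball z0 r" "T w z = z" by blast
  have "norm (z - z') \<le> 1/2 * norm (z - z') + L * norm (w - w')"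
    using est[OF ws(1,2) z(1) z'(1)] z z' by simp
  then show "\<exists>z\<in>cball z0 r. T w z = z \<and> norm (z - z') \<le> 2 * L * norm (w - w')"
    using z by (intro bexI[of _ z]) auto
qed

text \<open>\<open>G\<close> stands for the inverse of \<open>H\<close>. Eliminating \<open>x = G (p - l a)\<close> from the system in
  \<open>complementarity_solution_iff\<close> leaves a scalar complementarity problem for \<open>l\<close> with slope \<open>\<langle>a, G a\<rangle>\<close>.\<close>

definition complementarity_solution ::
  "('a::real_inner \<Rightarrow> 'a) \<Rightarrow> 'a \<Rightarrow> 'a \<Rightarrow> real \<Rightarrow> 'a \<times> real" where
  "complementarity_solution G a p q =
     (let l = max 0 ((inner a (G p) - q) / inner a (G a)) in (G (p - l *\<^sub>R a), l))"

lemma complementarity_solution_iff: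
  fixes G H :: "'a::real_inner \<Rightarrow> 'a"
  assumes G: "linear G" and GH: "\<And>x. G (H x) = x" and HG: "\<And>x. H (G x) = x"
    and pos: "inner a (G a) > 0"
  shows "(x, l) = complementarity_solution G a p q \<longleftrightarrow>
    H x + l *\<^sub>R a = p \<and> l \<ge> 0 \<and> inner a x \<le> q \<and> l * (inner a x - q) = 0"
proof -
  have *: "H x + l *\<^sub>R a = p \<longleftrightarrow> x = G (p - l *\<^sub>R a)"
    using GH HG by (metis add_diff_cancel_right' diff_add_cancel)
  have ax: "inner a (G (p - l *\<^sub>R a)) = inner a (G p) - l * inner a (G a)"
    by (simp add: linear_diff[OF G] linear_scale[OF G] inner_diff_right)
  have sol: "l = max 0 ((inner a (G p) - q) / inner a (G a)) \<longleftrightarrow>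
      l \<ge> 0 \<and> inner a (G p) - l * inner a (G a) \<le> q \<and> l * (inner a (G p) - l * inner a (G a) - q) = 0"
  proof -
    \<comment> \<open>\<open>c\<close> is the root of the scalar affine equation. Its slope is
      positive, so complementarity selects \<open>max 0 c\<close>.\<close>
    define c where "c = (inner a (G p) - q) / inner a (G a)"
    have c: "inner a (G p) = q + c * inner a (G a)" unfolding c_def using pos by simp
    have "l \<ge> 0 \<and> (c - l) * inner a (G a) \<le> 0 \<and> l * ((c - l) * inner a (G a)) = 0 \<longleftrightarrow> l = max 0 c"
      using pos by (auto simp: mult_le_0_iff max_def)
    then show ?thesis using pos unfolding c_def[symmetric] c by (simp add: algebra_simps)
  qed
  show ?thesis
  proof
    assume "(x, l) = complementarity_solution G a p q"
    then have l: "l = max 0 ((inner a (G p) - q) / inner a (G a))" and x: "x = G (p - l *\<^sub>R a)"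
      by (simp_all add: complementarity_solution_def Let_def)
    show "H x + l *\<^sub>R a = p \<and> l \<ge> 0 \<and> inner a x \<le> q \<and> l * (inner a x - q) = 0"
      using sol[THEN iffD1, OF l] x unfolding * by (simp only: ax)
  next
    assume R: "H x + l *\<^sub>R a = p \<and> l \<ge> 0 \<and> inner a x \<le> q \<and> l * (inner a x - q) = 0"
    then have x: "x = G (p - l *\<^sub>R a)" using * by blast
    then have "l = max 0 ((inner a (G p) - q) / inner a (G a))"
      using R unfolding sol by (simp only: ax)
    with x show "(x, l) = complementarity_solution G a p q"
      by (simp add: complementarity_solution_def Let_def)
  qed
qed

text \<open>Truncation by \<open>max 0\<close> is nonexpansive, so the multiplier is Lipschitz in
  the data; boundedness of \<open>G\<close> carries this over to the first component.\<close>

lemma complementarity_solution_lipschitz: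
  fixes G :: "'a::real_inner \<Rightarrow> 'a"
  assumes G: "bounded_linear G" and pos: "inner a (G a) > 0"
  obtains K where "K > 0"
    "\<And>p q p' q'. norm (complementarity_solution G a p q - complementarity_solution G a p' q')
      \<le> K * (norm (p - p') + \<bar>q - q'\<bar>)"
proof -
  interpret G: bounded_linear G by (rule G)
  obtain B where B: "B > 0" "\<And>x. norm (G x) \<le> B * norm x"
    using G.pos_bounded by (auto simp: mult.commute)
  \<comment> \<open>\<open>M\<close> is a Lipschitz constant of the multiplier; \<open>K\<close>
    below adds to it the constant \<open>B + B * M * norm a\<close> of the first component.\<close>
  define M where "M = (norm a * B + 1) / inner a (G a)"
  have M: "M > 0" unfolding M_def using pos B by (intro divide_pos_pos add_nonneg_pos) auto
  define K where "K = B + B * M * norm a + M"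
  show thesis
  proof
    show "K > 0" unfolding K_def using B M by (intro add_pos_pos add_pos_nonneg) auto
    fix p q p' q'
    define l where "l = max 0 ((inner a (G p) - q) / inner a (G a))"
    define l' where "l' = max 0 ((inner a (G p') - q') / inner a (G a))"
    define N where "N = norm (p - p') + \<bar>q - q'\<bar>"
    have N: "N \<ge> 0" "norm (p - p') \<le> N" "\<bar>q - q'\<bar> \<le> N" unfolding N_def by auto
    have "\<bar>l - l'\<bar> \<le> \<bar>(inner a (G p) - q) / inner a (G a) - (inner a (G p') - q') / inner a (G a)\<bar>"
      unfolding l_def l'_def by (auto simp: max_def)
    also have "\<dots> = \<bar>inner a (G (p - p')) - (q - q')\<bar> / inner a (G a)"
      using pos by (simp add: G.diff inner_diff_right flip: diff_divide_distrib)
    also have "\<dots> \<le> ((norm a * B + 1) * N) / inner a (G a)"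
    proof (rule divide_right_mono)
      have "\<bar>inner a (G (p - p'))\<bar> \<le> norm a * (B * norm (p - p'))"
        by (rule order.trans[OF Cauchy_Schwarz_ineq2 mult_left_mono[OF B(2)]]) simp
      also have "\<dots> \<le> norm a * (B * N)" using B N by (intro mult_left_mono) auto
      finally show "\<bar>inner a (G (p - p')) - (q - q')\<bar> \<le> (norm a * B + 1) * N"
        using N by (simp add: algebra_simps)
    qed (use pos in simp)
    finally have l: "\<bar>l - l'\<bar> \<le> M * N" by (simp add: M_def)
    have "norm (G (p - l *\<^sub>R a) - G (p' - l' *\<^sub>R a)) = norm (G ((p - p') - (l - l') *\<^sub>R a))"
      by (simp add: algebra_simps flip: G.diff)
    also have "\<dots> \<le> B * (norm (p - p') + \<bar>l - l'\<bar> * norm a)"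
      by (rule order.trans[OF B(2) mult_left_mono])
        (use B norm_triangle_ineq4[of "p - p'" "(l - l') *\<^sub>R a"] in auto)
    also have "\<dots> \<le> B * (N + M * N * norm a)"
      using B N l by (intro mult_left_mono add_mono mult_right_mono) auto
    finally have "norm (G (p - l *\<^sub>R a) - G (p' - l' *\<^sub>R a)) \<le> B * (N + M * N * norm a)" .
    then have "norm (G (p - l *\<^sub>R a) - G (p' - l' *\<^sub>R a), l - l') \<le> B * (N + M * N * norm a) + M * N"
      using l by (intro order.trans[OF norm_Pair_le] add_mono) auto
    also have "\<dots> = K * N" unfolding K_def by (simp add: algebra_simps)
    finally show "norm (complementarity_solution G a p q - complementarity_solution G a p' q')
      \<le> K * (norm (p - p') + \<bar>q - q'\<bar>)"
      unfolding complementarity_solution_def Let_def l_def[symmetric] l'_def[symmetric] N_def by simp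
  qed
qed

subsection \<open>The stationary point map\<close>

text \<open>Reduces stationarity to the KKT system by the formula for the normal cone. The gradient
  condition concerns only the point itself, so the lemma applies at neighbouring points as soon as
  the gradient is nonzero there.\<close>

lemma stationary_set_iff:
  fixes f0 F :: "(real^'n) \<times> (real^'d) \<Rightarrow> real"
  assumes F: "twice_continuously_differentiable F" and nz: "grad_x F x w \<noteq> 0"
  shows "x \<in> stationary_set f0 F w \<longleftrightarrow>
    F (x, w) \<le> 0 \<and> (\<exists>l\<ge>0. grad_x f0 x w + l *\<^sub>R grad_x F x w = 0 \<and> l * F (x, w) = 0)"
proof -
  obtain F' A' where "second_order_data F F' A'"
    using twice_continuously_differentiable_second_order_data[OF F] by blast
  then interpret F: second_order_data F F' A' .
  have der: "((\<lambda>y. F (y, w)) has_derivative (\<lambda>h. inner (grad_x F y w) h)) (at y)" for y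
    unfolding inner_grad_x[OF F.deriv] by (rule has_derivative_fst_section[OF F.deriv])
  have cont: "isCont (\<lambda>y. grad_x F y w) x"
    using has_derivative_continuous[OF has_derivative_fst_section[OF F.grad_deriv[of "(x, w)"]]] by simp
  have "x \<in> stationary_set f0 F w \<longleftrightarrow> - grad_x f0 x w \<in> limiting_normal_cone {y. F (y, w) \<le> 0} x"
    unfolding stationary_set_def feasible_set_def
    by (simp add: image_iff Bex_def) (metis add.right_inverse add_eq_0_iff)
  also have "\<dots> \<longleftrightarrow> F (x, w) \<le> 0 \<and> (\<exists>l\<ge>0. - grad_x f0 x w = l *\<^sub>R grad_x F x w \<and> l * F (x, w) = 0)"
    by (rule limiting_normal_sublevel_iff[OF der cont nz])
  finally show ?thesis
    using minus_unique[of "grad_x f0 x w"] by (metis add.right_inverse)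
qed

text \<open>A contraction needs a small constant in \<open>x\<close> only. The w-part of the
  derivative is therefore moved to the right-hand side, where any constant \<open>M\<close> is
  acceptable.\<close>

lemma strict_partial_estimate:
  fixes f :: "'a::real_normed_vector \<times> 'b::real_normed_vector \<Rightarrow> 'c::real_normed_vector"
    and f' :: "'a \<times> 'b \<Rightarrow> ('a \<times> 'b) \<Rightarrow>\<^sub>L 'c"
  assumes der: "\<And>z. (f has_derivative blinfun_apply (f' z)) (at z)"
    and cont: "isCont f' (x0, w0)" and e: "e > 0"
  obtains d M where "d > 0" "M \<ge> 0"
    "\<And>x x' w w'. dist x x0 < d \<Longrightarrow> dist x' x0 < d \<Longrightarrow> dist w w0 < d \<Longrightarrow> dist w' w0 < d \<Longrightarrow>
      norm (f (x, w) - f (x', w') - f' (x0, w0) (x - x', 0)) \<le> e * norm (x - x') + M * norm (w - w')"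
proof -
  obtain d where d: "d > 0" "\<And>y z. y \<in> ball (x0, w0) d \<Longrightarrow> z \<in> ball (x0, w0) d \<Longrightarrow>
      norm (f y - f z - f' (x0, w0) (y - z)) \<le> e * norm (y - z)"
    using strict_derivative_estimate[OF der cont e] by blast
  let ?D = "f' (x0, w0)"
  show thesis
  \<comment> \<open>Halving \<open>d\<close> places pairs in the ball of the product space; in
    \<open>M\<close> the term \<open>e\<close> is the strict error and \<open>norm ?D\<close> bounds
    the derivative in \<open>w\<close>.\<close>
  proof (rule that[of "d / 2" "e + norm ?D"])
    fix x x' w w'
    assume "dist x x0 < d / 2" "dist x' x0 < d / 2" "dist w w0 < d / 2" "dist w' w0 < d / 2"
    then have "(x, w) \<in> ball (x0, w0) d" "(x', w') \<in> ball (x0, w0) d"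
      using norm_Pair_le[of "x0 - x" "w0 - w"] norm_Pair_le[of "x0 - x'" "w0 - w'"]
      by (auto simp: dist_norm norm_minus_commute)
    from d(2)[OF this] have
      "norm (f (x, w) - f (x', w') - ?D (x - x', w - w')) \<le> e * norm (x - x', w - w')" by simp
    also have "\<dots> \<le> e * (norm (x - x') + norm (w - w'))"
      using e by (intro mult_left_mono norm_Pair_le) auto
    finally have 1: "norm (f (x, w) - f (x', w') - ?D (x - x', w - w')) \<le> e * (norm (x - x') + norm (w - w'))" .
    have 2: "norm (?D (0, w - w')) \<le> norm ?D * norm (w - w')"
      using norm_blinfun[of ?D "(0, w - w')"] by (simp add: norm_Pair)
    have "f (x, w) - f (x', w') - ?D (x - x', 0) = (f (x, w) - f (x', w') - ?D (x - x', w - w')) + ?D (0, w - w')"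
    proof -
      have "?D (x - x', w - w') = ?D (x - x', 0) + ?D (0, w - w')" by (simp flip: blinfun.add_right)
      then show ?thesis by simp
    qed
    then have "norm (f (x, w) - f (x', w') - ?D (x - x', 0)) \<le> e * (norm (x - x') + norm (w - w')) + norm ?D * norm (w - w')"
      using norm_triangle_mono[OF 1 2] by (simp only:)
    then show "norm (f (x, w) - f (x', w') - ?D (x - x', 0)) \<le> e * norm (x - x') + (e + norm ?D) * norm (w - w')"
      by (simp add: algebra_simps)
  qed (use d e in auto)
qed

section \<open>Assertion (a): the kernel inclusion as a necessary condition\<close>

lemma lipschitz_like_imp_kernel:
  fixes f0 F :: "(real^'n) \<times> (real^'d) \<Rightarrow> real"
  assumes f0: "twice_continuously_differentiable f0" and F: "twice_continuously_differentiable F"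
    and F0: "F (xbar, wbar) = 0" and nz: "grad_x F xbar wbar \<noteq> 0" and g0: "grad_x f0 xbar wbar = 0"
    and lip: "locally_lipschitz_like (stationary_set f0 F) wbar xbar"
    and ker: "hess_xx f0 xbar wbar *v v + \<gamma> *\<^sub>R grad_x F xbar wbar = 0"
    and v: "inner (grad_x F xbar wbar) v \<ge> 0" and \<gamma>: "\<gamma> \<ge> 0"
  shows "hess_wx f0 xbar wbar *v v + \<gamma> *\<^sub>R grad_w F xbar wbar = 0"
proof (rule ccontr)
  define a where "a = grad_x F xbar wbar"
  define \<eta> where "\<eta> = hess_wx f0 xbar wbar *v v + \<gamma> *\<^sub>R grad_w F xbar wbar"
  assume "hess_wx f0 xbar wbar *v v + \<gamma> *\<^sub>R grad_w F xbar wbar \<noteq> 0"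
  then have \<eta>: "norm \<eta> > 0" by (simp add: \<eta>_def)
  define zb where "zb = (xbar, wbar)"
  define g where "g z = grad_x f0 (fst z) (snd z)" for z
  define A where "A z = grad_x F (fst z) (snd z)" for z
  obtain F' A' where "second_order_data F F' A'"
    using twice_continuously_differentiable_second_order_data[OF F] by blast
  then interpret F: second_order_data F F' A' .
  obtain f0' g' where "second_order_data f0 f0' g'"
    using twice_continuously_differentiable_second_order_data[OF f0] by blast
  then interpret f0: second_order_data f0 f0' g' .
  have g': "(g has_derivative blinfun_apply (g' z)) (at z)" for z
    using f0.grad_deriv[of z] by (simp add: g_def[abs_def])
  have A': "(A has_derivative blinfun_apply (A' z)) (at z)" for z
    using F.grad_deriv[of z] by (simp add: A_def[abs_def])
  note g'x = f0.grad_deriv_x[of xbar wbar, folded zb_def]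
    and g'w = f0.inner_grad_deriv_w[of _ xbar wbar, folded zb_def]
    and sym = f0.hess_xx_symmetric[of xbar wbar]
    and F'xw = F.deriv_pair[of xbar wbar, folded zb_def a_def] and F' = F.deriv
  have Azb: "A zb = a" and gzb: "g zb = 0" and anz: "norm a > 0"
    using nz g0 by (simp_all add: A_def g_def zb_def a_def)
  obtain m U V where m: "m > 0" and UV: "xbar \<in> interior U" "wbar \<in> interior V"
    and xS: "xbar \<in> stationary_set f0 F wbar"
    and LL: "\<And>w w'. w \<in> V \<Longrightarrow> w' \<in> V \<Longrightarrow> stationary_set f0 F w' \<inter> U \<subseteq>
      {y + (m * norm (w' - w)) *\<^sub>R b | y b. y \<in> stationary_set f0 F w \<and> b \<in> cball 0 1}"
    using lip unfolding locally_lipschitz_like_def by blast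
  define \<Psi> where "\<Psi> z = inner v (g z) + \<gamma> * F z" for z
  have \<Psi>': "(\<Psi> has_derivative (\<lambda>h. inner \<eta> (snd h))) (at zb)"
  proof -
    have "(\<Psi> has_derivative (\<lambda>h. inner v (g' zb h) + \<gamma> * F' zb h)) (at zb)"
      unfolding \<Psi>_def by (auto intro!: derivative_eq_intros g' F')
    \<comment> \<open>The x-part vanishes: symmetry of the Hessian moves it onto \<open>v\<close>,
      where the kernel equation \<open>ker\<close> cancels it.\<close>
    moreover have "inner v (g' zb h) + \<gamma> * F' zb h = inner \<eta> (snd h)" for h
    proof (cases h)
      case (Pair p q)
      have "g' zb (p, q) = g' zb (p, 0) + g' zb (0, q)" by (simp flip: blinfun.add_right)
      moreover have "inner (hess_xx f0 xbar wbar *v v) p + \<gamma> * inner a p = 0"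
        using arg_cong[OF ker, of "\<lambda>u. inner u p"] by (simp add: inner_add_left a_def)
      ultimately show ?thesis
        by (simp add: Pair F'xw inner_add_right g'x g'w \<eta>_def inner_add_left algebra_simps flip: sym)
    qed
    ultimately show ?thesis by simp
  qed
  \<comment> \<open>Bounds the multiplier by \<open>C * norm (z - zb)\<close>, from the first-order
    bound on \<open>g\<close> and \<open>norm (A z) \<ge> norm a / 2\<close>.\<close>
  define C where "C = 2 * (norm (g' zb) + 1) / norm a"
  have C: "C > 0" unfolding C_def using anz by (simp add: add_nonneg_pos)
  \<comment> \<open>Chosen so that the total error at the end is exactly half of
    \<open>norm \<eta> * (t * norm \<eta>)\<close>.\<close>
  define e where "e = norm \<eta> / (2 * (C * norm v + 1) * (m + 1))"
  have Cv: "C * norm v + 1 > 0" using C by (simp add: add_nonneg_pos)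
  have e: "e > 0" unfolding e_def using \<eta> Cv m by (intro divide_pos_pos mult_pos_pos) auto
  have evP: "\<forall>\<^sub>F z in nhds zb. \<bar>\<Psi> z - inner \<eta> (snd (z - zb))\<bar> \<le> e * norm (z - zb)"
  proof -
    have "\<exists>d>0. \<forall>y. norm (y - zb) < d \<longrightarrow> norm (\<Psi> y - \<Psi> zb - inner \<eta> (snd (y - zb))) \<le> e * norm (y - zb)"
      using \<Psi>' e unfolding has_derivative_at_alt by blast
    moreover have "\<Psi> zb = 0" using F0 unfolding \<Psi>_def gzb by (simp add: zb_def)
    ultimately show ?thesis by (simp add: eventually_nhds_metric dist_norm)
  qed
  have evg: "\<forall>\<^sub>F z in nhds zb. norm (g z) \<le> (norm (g' zb) + 1) * norm (z - zb)"
  proof -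
    obtain d where d: "d > 0" "\<And>y. norm (y - zb) < d \<Longrightarrow> norm (g y - g zb - g' zb (y - zb)) \<le> 1 * norm (y - zb)"
      using g'[of zb] unfolding has_derivative_at_alt by (metis zero_less_one)
    have "norm (g y) \<le> (norm (g' zb) + 1) * norm (y - zb)" if "norm (y - zb) < d" for y
      using norm_triangle_mono[OF d(2)[OF that] norm_blinfun[of "g' zb" "y - zb"]]
      by (simp add: gzb algebra_simps)
    then show ?thesis using d(1) by (auto simp: eventually_nhds_metric dist_norm)
  qed
  have evA: "\<forall>\<^sub>F z in nhds zb. dist (A z) a < min e (norm a / 2)"
  proof -
    have "(A \<longlongrightarrow> a) (nhds zb)"
      using has_derivative_continuous[OF A'[of zb]] tendsto_at_iff_tendsto_nhds[of A zb]
      by (simp add: continuous_within Azb)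
    then show ?thesis using e anz by (intro tendstoD) auto
  qed
  obtain d where d: "d > 0" and near: "\<And>z. dist z zb < d \<Longrightarrow>
      \<bar>\<Psi> z - inner \<eta> (snd (z - zb))\<bar> \<le> e * norm (z - zb) \<and>
      norm (g z) \<le> (norm (g' zb) + 1) * norm (z - zb) \<and> dist (A z) a < min e (norm a / 2)"
    using eventually_conj[OF evP eventually_conj[OF evg evA]] unfolding eventually_nhds_metric by blast
  obtain s where s: "s > 0" "ball wbar s \<subseteq> V"
    using UV(2) by (auto simp: mem_interior)
  \<comment> \<open>Small enough that \<open>w\<close> stays in \<open>V\<close> and the point
    \<open>z\<close> found over \<open>w\<close> stays within \<open>d\<close> of
    \<open>zb\<close>.\<close>
  define t where "t = min (s / 2) (d / (2 * (m + 1))) / norm \<eta>"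
  have t: "t > 0" unfolding t_def using s d \<eta> m by (intro divide_pos_pos) auto
  have tn: "t * norm \<eta> = min (s / 2) (d / (2 * (m + 1)))" unfolding t_def using \<eta> by simp
  define w where "w = wbar + t *\<^sub>R \<eta>"
  have ww: "norm (w - wbar) = t * norm \<eta>" "norm (wbar - w) = t * norm \<eta>"
    using t by (simp_all add: w_def)
  have wV: "w \<in> V" "wbar \<in> V"
    using s ww tn by (auto intro!: subsetD[OF s(2)] simp: dist_norm)
  \<comment> \<open>The Lipschitz-like property is applied to the reference point
    \<open>xbar\<close> itself, moving from \<open>wbar\<close> to \<open>w\<close>.\<close>
  have "xbar \<in> stationary_set f0 F wbar \<inter> U" using xS UV(1) interior_subset by blast
  with LL[OF wV] obtain x b where xb: "xbar = x + (m * norm (wbar - w)) *\<^sub>R b"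
    and x: "x \<in> stationary_set f0 F w" and b: "b \<in> cball 0 1" by blast
  have "norm (x - xbar) \<le> m * (t * norm \<eta>)"
  proof -
    have "norm (x - xbar) = m * (t * norm \<eta>) * norm b"
      using m t by (simp add: xb ww abs_mult)
    also have "\<dots> \<le> m * (t * norm \<eta>) * 1" using b m t by (intro mult_left_mono) auto
    finally show ?thesis by simp
  qed
  define z where "z = (x, w)"
  have z: "norm (z - zb) \<le> (m + 1) * (t * norm \<eta>)"
    using norm_Pair_le[of "x - xbar" "w - wbar"] \<open>norm (x - xbar) \<le> _\<close> ww
    by (simp add: z_def zb_def algebra_simps)
  also have "\<dots> \<le> (m + 1) * (d / (2 * (m + 1)))"
    unfolding tn using m by (intro mult_left_mono) auto
  also have "\<dots> = d / 2" using m by (simp add: field_simps)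
  also have "\<dots> < d" using d by simp
  finally have "dist z zb < d" by (simp add: dist_norm)
  note nz = near[OF this]
  have "norm a \<le> norm (A z) + dist (A z) a"
    using norm_triangle_sub[of a "A z"] by (simp add: dist_norm norm_minus_commute)
  then have Az: "norm (A z) \<ge> norm a / 2" using nz by linarith
  then have "A z \<noteq> 0" using anz by auto
  then obtain l where Fz: "F z \<le> 0" and l: "l \<ge> 0" "g z + l *\<^sub>R A z = 0"
    using x stationary_set_iff[OF F, of x w f0] by (auto simp: A_def g_def z_def)
  have l': "l \<le> C * norm (z - zb)"
  proof -
    have "l * (norm a / 2) \<le> l * norm (A z)" using l Az by (intro mult_left_mono)
    also have "\<dots> = norm (g z)" using l by (simp add: eq_neg_iff_add_eq_0[symmetric])
    also have "\<dots> \<le> (norm (g' zb) + 1) * norm (z - zb)" using nz by blast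
    finally show ?thesis unfolding C_def using anz by (simp add: field_simps)
  qed
  \<comment> \<open>The sign condition at the base point survives up to \<open>norm v * e\<close>.
    Multiplied by \<open>l\<close>, which is of first order, this bounds \<open>\<Psi> z\<close>
    from above.\<close>
  have "inner v (A z) \<ge> - (norm v * e)"
  proof -
    have "\<bar>inner v (A z - a)\<bar> \<le> norm v * norm (A z - a)" by (rule Cauchy_Schwarz_ineq2)
    also have "\<dots> \<le> norm v * e" using nz by (intro mult_left_mono) (auto simp: dist_norm)
    finally show ?thesis using v by (simp add: inner_diff_right a_def inner_commute)
  qed
  then have "l * (- (norm v * e)) \<le> l * inner v (A z)" using l by (intro mult_left_mono)
  moreover have "inner v (g z) = - (l * inner v (A z))"
    using l(2) by (metis add_eq_0_iff2 inner_minus_right inner_scaleR_right)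
  moreover have "\<gamma> * F z \<le> 0" using \<gamma> Fz by (simp add: mult_nonneg_nonpos)
  ultimately have "\<Psi> z \<le> l * (norm v * e)" unfolding \<Psi>_def by linarith
  also have "\<dots> \<le> C * norm (z - zb) * (norm v * e)" using l' e by (intro mult_right_mono) auto
  finally have "\<Psi> z \<le> C * norm (z - zb) * (norm v * e)" .
  then have "inner \<eta> (snd (z - zb)) \<le> (C * norm v + 1) * e * norm (z - zb)"
  proof -
    have "(C * norm v + 1) * e * norm (z - zb) = C * norm (z - zb) * (norm v * e) + e * norm (z - zb)"
      by (simp add: algebra_simps)
    moreover have "\<bar>\<Psi> z - inner \<eta> (snd (z - zb))\<bar> \<le> e * norm (z - zb)" using nz by blast
    ultimately show ?thesis using \<open>\<Psi> z \<le> C * norm (z - zb) * (norm v * e)\<close> by linarith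
  qed
  \<comment> \<open>Since \<open>w\<close> moves along \<open>\<eta>\<close>, the left-hand side of
    this chain is \<open>norm \<eta> * (t * norm \<eta>)\<close>, while the right-hand side becomes
    half of it.\<close>
  also have "\<dots> \<le> (C * norm v + 1) * e * ((m + 1) * (t * norm \<eta>))"
    using z Cv e by (intro mult_left_mono) auto
  also have "\<dots> = (norm \<eta> / 2) * (t * norm \<eta>)"
    unfolding e_def using Cv m by (simp add: divide_simps)
  also have "inner \<eta> (snd (z - zb)) = norm \<eta> * (t * norm \<eta>)"
    by (simp add: z_def zb_def w_def dot_square_norm power2_eq_square)
  also have "norm \<eta> / 2 * (t * norm \<eta>) = norm \<eta> * (t * norm \<eta>) / 2" by simp
  finally show False using mult_pos_pos[OF \<eta> mult_pos_pos[OF t \<eta>]] by linarith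
qed

section \<open>Assertion (b): the Lipschitz-like property from strong regularity\<close>

lemma strongly_regular_imp_lipschitz_like:
  fixes f0 F :: "(real^'n) \<times> (real^'d) \<Rightarrow> real"
  assumes f0: "twice_continuously_differentiable f0" and F: "twice_continuously_differentiable F"
    and F0: "F (xbar, wbar) = 0" and nz: "grad_x F xbar wbar \<noteq> 0" and g0: "grad_x f0 xbar wbar = 0"
    and G: "linear G" and GH: "\<And>v. G (hess_xx f0 xbar wbar *v v) = v"
    and HG: "\<And>v. hess_xx f0 xbar wbar *v G v = v"
    and pos: "inner (grad_x F xbar wbar) (G (grad_x F xbar wbar)) > 0"
  shows "locally_lipschitz_like (stationary_set f0 F) wbar xbar"
proof -
  define a where "a = grad_x F xbar wbar"
  define H where "H v = hess_xx f0 xbar wbar *v v" for v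
  define zb where "zb = (xbar, wbar)"
  define g where "g z = grad_x f0 (fst z) (snd z)" for z
  define A where "A z = grad_x F (fst z) (snd z)" for z
  obtain F' A' where "second_order_data F F' A'"
    using twice_continuously_differentiable_second_order_data[OF F] by blast
  then interpret F: second_order_data F F' A' .
  obtain f0' g' where "second_order_data f0 f0' g'"
    using twice_continuously_differentiable_second_order_data[OF f0] by blast
  then interpret f0: second_order_data f0 f0' g' .
  have g': "(g has_derivative blinfun_apply (g' z)) (at z)" for z
    using f0.grad_deriv[of z] by (simp add: g_def[abs_def])
  have A': "(A has_derivative blinfun_apply (A' z)) (at z)" for z
    using F.grad_deriv[of z] by (simp add: A_def[abs_def])
  have Azb: "A zb = a" and gzb: "g zb = 0" and anz: "norm a > 0"
    using nz g0 by (simp_all add: A_def g_def zb_def a_def)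
  have posa: "inner a (G a) > 0" using pos by (simp add: a_def)
  have xS: "xbar \<in> stationary_set f0 F wbar"
    using stationary_set_iff[OF F nz] F0 g0 by auto
  obtain K where K: "K > 0"
    "\<And>p q p' q'. norm (complementarity_solution G a p q - complementarity_solution G a p' q')
      \<le> K * (norm (p - p') + \<bar>q - q'\<bar>)"
    using complementarity_solution_lipschitz[OF linear_conv_bounded_linear[THEN iffD1, OF G] posa] by blast
  \<comment> \<open>The data \<open>P\<close> and \<open>Q\<close> below vary by at most
    \<open>4 * e\<close> times the distance in \<open>z\<close>; multiplied by \<open>K\<close> this
    is the contraction factor 1/2.\<close>
  define e where "e = 1 / (8 * K)"
  have e: "e > 0" unfolding e_def using K(1) by simp
  define C where "C = norm (A' zb) + 1"
  have C: "C > 0" unfolding C_def by (simp add: add_nonneg_pos)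
  obtain d1 M1 where d1: "d1 > 0" "M1 \<ge> 0"
    and est_g: "\<And>x x' w w'. dist x xbar < d1 \<Longrightarrow> dist x' xbar < d1 \<Longrightarrow> dist w wbar < d1 \<Longrightarrow> dist w' wbar < d1 \<Longrightarrow>
      norm (g (x, w) - g (x', w') - g' (xbar, wbar) (x - x', 0)) \<le> e * norm (x - x') + M1 * norm (w - w')"
    using strict_partial_estimate[OF g' f0.isCont_grad_deriv e] by blast
  obtain d2 M2 where d2: "d2 > 0" "M2 \<ge> 0"
    and est_A: "\<And>x x' w w'. dist x xbar < d2 \<Longrightarrow> dist x' xbar < d2 \<Longrightarrow> dist w wbar < d2 \<Longrightarrow> dist w' wbar < d2 \<Longrightarrow>
      norm (A (x, w) - A (x', w') - A' (xbar, wbar) (x - x', 0)) \<le> 1 * norm (x - x') + M2 * norm (w - w')"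
    using strict_partial_estimate[OF A' F.isCont_grad_deriv zero_less_one] by blast
  obtain d3 M3 where d3: "d3 > 0" "M3 \<ge> 0"
    and est_F: "\<And>x x' w w'. dist x xbar < d3 \<Longrightarrow> dist x' xbar < d3 \<Longrightarrow> dist w wbar < d3 \<Longrightarrow> dist w' wbar < d3 \<Longrightarrow>
      norm (F (x, w) - F (x', w') - F' (xbar, wbar) (x - x', 0)) \<le> e * norm (x - x') + M3 * norm (w - w')"
    using strict_partial_estimate[OF F.deriv F.isCont_deriv e] by blast
  have limA: "(A \<longlongrightarrow> a) (nhds zb)" and limg: "(g \<longlongrightarrow> 0) (nhds zb)"
    using has_derivative_continuous[OF A'[of zb]] tendsto_at_iff_tendsto_nhds[of A zb]
      has_derivative_continuous[OF g'[of zb]] tendsto_at_iff_tendsto_nhds[of g zb]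
    by (simp_all add: continuous_within Azb gzb)
  have near_product: "\<exists>d>0. \<forall>x w. dist x xbar < d \<longrightarrow> dist w wbar < d \<longrightarrow> R (x, w)"
    if "\<forall>\<^sub>F z in nhds zb. R z" for R
  proof -
    from that[unfolded eventually_nhds_metric] obtain d
      where d: "d > 0" "\<forall>z. dist z zb < d \<longrightarrow> R z" by (elim exE conjE)
    have "R (x, w)" if "dist x xbar < d / 2" "dist w wbar < d / 2" for x w
      using that norm_Pair_le[of "x - xbar" "w - wbar"] by (intro d(2)[rule_format]) (simp add: zb_def dist_norm)
    then show ?thesis using d(1) by (intro exI[of _ "d / 2"]) auto
  qed
  have "\<forall>\<^sub>F z in nhds zb. dist (A z) a < min e (norm a / 2)"
    using limA e anz by (intro tendstoD) auto
  from near_product[OF this] obtain d4 where d4: "d4 > 0"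
    "\<And>x w. dist x xbar < d4 \<Longrightarrow> dist w wbar < d4 \<Longrightarrow> dist (A (x, w)) a < min e (norm a / 2)"
    by blast
  have A_lower: "norm (A (x, w)) \<ge> norm a / 2" if "dist x xbar < d4" "dist w wbar < d4" for x w
    using d4(2)[OF that] norm_triangle_sub[of a "A (x, w)"] by (simp add: dist_norm norm_minus_commute)
  \<comment> \<open>The multiplier at the base point is zero, so multipliers in the ball of radius
    \<open>r\<close> are at most \<open>s\<close>. The bound \<open>e / C\<close> then makes
    multiplier times variation of \<open>A\<close> in \<open>x\<close> small, and the bound 1
    preserves the constant \<open>M2\<close>.\<close>
  define s where "s = min (min (min d1 d2) (min d3 d4)) (min (e / C) 1)"
  have s: "s > 0" "s \<le> d1" "s \<le> d2" "s \<le> d3" "s \<le> d4" "s \<le> e / C" "s \<le> 1"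
    unfolding s_def using d1 d2 d3 d4 e C by auto
  define r where "r = s / 2"
  have r: "r > 0" "r < s" unfolding r_def using s by auto
  \<comment> \<open>\<open>P\<close> and \<open>Q\<close> are the differences between the system
    linearized at the base point and the true one. \<open>T\<close> solves the linearized system
    with these data frozen at \<open>z\<close>; at a fixed point the linear parts cancel and the KKT
    system remains.\<close>
  define P where "P w z = H (fst z) + snd z *\<^sub>R a - (g (fst z, w) + snd z *\<^sub>R A (fst z, w))" for w z
  define Q where "Q w z = inner a (fst z) - F (fst z, w)" for w and z :: "(real^'n) \<times> real"
  define T where "T w z = complementarity_solution G a (P w z) (Q w z)" for w z
  have T_fix: "T w (x, l) = (x, l) \<longleftrightarrow>
      g (x, w) + l *\<^sub>R A (x, w) = 0 \<and> l \<ge> 0 \<and> F (x, w) \<le> 0 \<and> l * F (x, w) = 0" for w x l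
  proof -
    have "T w (x, l) = (x, l) \<longleftrightarrow> (x, l) = complementarity_solution G a (P w (x, l)) (Q w (x, l))"
      unfolding T_def by (rule eq_commute)
    also have "\<dots> \<longleftrightarrow> H x + l *\<^sub>R a = P w (x, l) \<and> l \<ge> 0 \<and> inner a x \<le> Q w (x, l)
        \<and> l * (inner a x - Q w (x, l)) = 0"
      by (rule complementarity_solution_iff[OF G _ _ posa]) (simp_all add: H_def GH HG)
    finally show ?thesis by (simp add: P_def Q_def neg_eq_iff_add_eq_0)
  qed
  define L where "L = K * (M1 + M2 + M3)"
  have L: "L \<ge> 0" unfolding L_def using K d1 d2 d3 by simp
  have est_T: "norm (T w z - T w' z') \<le> 1/2 * norm (z - z') + L * norm (w - w')"
    if w: "w \<in> ball wbar s" "w' \<in> ball wbar s" and z: "z \<in> cball (xbar, 0) r" "z' \<in> cball (xbar, 0) r"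
    for w w' z z'
  proof -
    obtain x l x' l' where zz: "z = (x, l)" "z' = (x', l')" by (cases z, cases z')
    have dx: "dist x xbar < s" "dist x' xbar < s" and dl: "\<bar>l'\<bar> \<le> s"
      using z r order.trans[OF dist_fst_le] order.trans[OF dist_snd_le]
      by (fastforce simp: zz dist_commute)+
    have dw: "dist w wbar < s" "dist w' wbar < s" using w by (simp_all add: dist_commute)
    define N where "N = norm (z - z')"
    define W where "W = norm (w - w')"
    have NW: "N \<ge> 0" "W \<ge> 0" unfolding N_def W_def by simp_all
    have xN: "norm (x - x') \<le> N" and lN: "\<bar>l - l'\<bar> \<le> N"
      using norm_fst_le[of "x - x'" "l - l'"] norm_snd_le[of "l - l'" "x - x'"] by (simp_all add: N_def zz)
    have "norm (H (x - x') - (g (x, w) - g (x', w'))) \<le> e * norm (x - x') + M1 * W"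
      using est_g[of x x' w w'] dx dw s
      by (simp add: W_def f0.grad_deriv_x H_def norm_minus_commute)
    also have "\<dots> \<le> e * N + M1 * W" using xN e by (intro add_right_mono mult_left_mono) auto
    finally have 1: "norm (H (x - x') - (g (x, w) - g (x', w'))) \<le> e * N + M1 * W" .
    have 2: "norm ((l - l') *\<^sub>R (a - A (x, w))) \<le> N * e"
      using lN NW d4(2)[of x w] dx dw s by (auto simp: dist_norm norm_minus_commute intro!: mult_mono)
    have 3: "norm (l' *\<^sub>R (A (x', w') - A (x, w))) \<le> e * N + M2 * W"
    proof -
      have "norm (A (x, w) - A (x', w') - A' zb (x - x', 0)) \<le> norm (x - x') + M2 * W"
        using est_A[of x x' w w'] dx dw s by (simp add: W_def zb_def)
      moreover have "norm (A' zb (x - x', 0)) \<le> norm (A' zb) * norm (x - x')"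
        using norm_blinfun[of "A' zb" "(x - x', 0)"] by (simp add: norm_Pair)
      ultimately have "norm (A (x, w) - A (x', w')) \<le> C * norm (x - x') + M2 * W"
        using norm_triangle_sub[of "A (x, w) - A (x', w')" "A' zb (x - x', 0)"]
        by (simp add: C_def algebra_simps)
      also have "\<dots> \<le> C * N + M2 * W" using xN C by (intro add_right_mono mult_left_mono) auto
      finally have "norm (A (x', w') - A (x, w)) \<le> C * N + M2 * W" by (simp add: norm_minus_commute)
      then have "norm (l' *\<^sub>R (A (x', w') - A (x, w))) \<le> s * (C * N + M2 * W)"
        using dl s(1) by (simp add: mult_mono)
      also have "\<dots> = (s * C) * N + s * (M2 * W)" by (simp add: algebra_simps)
      also have "\<dots> \<le> e * N + 1 * (M2 * W)"
        using s C NW d2 by (intro add_mono mult_right_mono) (auto simp: field_simps)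
      finally show ?thesis by simp
    qed
    \<comment> \<open>The change of the product of multiplier and gradient is split so that each
      summand has a small factor: \<open>a - A (x, w)\<close> in one, \<open>l'\<close> in the
      other.\<close>
    have "P w z - P w' z' = (H (x - x') - (g (x, w) - g (x', w'))) + (l - l') *\<^sub>R (a - A (x, w))
        + l' *\<^sub>R (A (x', w') - A (x, w))"
      by (simp add: P_def zz H_def matrix_vector_mult_diff_distrib algebra_simps)
    then have "norm (P w z - P w' z') \<le> e * N + M1 * W + N * e + (e * N + M2 * W)"
      using norm_triangle_mono[OF norm_triangle_mono[OF 1 2] 3] by (simp only:)
    then have P: "norm (P w z - P w' z') \<le> 3 * (e * N) + (M1 + M2) * W"
      by (simp add: algebra_simps)
    have "F' zb (x - x', 0) = inner a (x - x')" by (simp add: zb_def F.deriv_pair a_def)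
    then have "\<bar>Q w z - Q w' z'\<bar> \<le> e * norm (x - x') + M3 * W"
      using est_F[of x x' w w'] dx dw s
      by (simp add: W_def zb_def Q_def zz inner_diff_right abs_le_iff)
    also have "\<dots> \<le> e * N + M3 * W" using xN e by (intro add_right_mono mult_left_mono) auto
    finally have "norm (P w z - P w' z') + \<bar>Q w z - Q w' z'\<bar> \<le> 4 * (e * N) + (M1 + M2 + M3) * W"
      using P by (simp add: algebra_simps)
    then have "norm (T w z - T w' z') \<le> K * (4 * (e * N) + (M1 + M2 + M3) * W)"
      unfolding T_def using K(1) by (intro order.trans[OF K(2)] mult_left_mono) auto
    also have "\<dots> = 1/2 * N + L * W" unfolding e_def L_def using K(1) by (simp add: field_simps)
    finally show ?thesis by (simp add: N_def W_def)
  qed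
  have "T wbar (xbar, 0) = (xbar, 0)" using F0 gzb by (simp add: T_fix zb_def)
  from parametrized_contraction[of T, OF this r(1) s(1) L est_T] obtain \<rho> where \<rho>: "\<rho> > 0" "\<rho> \<le> s"
    and fp: "\<And>w w' z'. w \<in> ball wbar \<rho> \<Longrightarrow> w' \<in> ball wbar \<rho> \<Longrightarrow> z' \<in> cball (xbar, 0) r \<Longrightarrow> T w' z' = z' \<Longrightarrow>
      \<exists>z\<in>cball (xbar, 0) r. T w z = z \<and> norm (z - z') \<le> 2 * L * norm (w - w')"
    by blast
  \<comment> \<open>With \<open>norm (A (x, w)) \<ge> norm a / 2\<close> this forces multipliers
    below \<open>r / 2\<close>, so stationary points in \<open>U\<close>, paired with their
    multipliers, lie in the ball where the contraction acts.\<close>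
  have "\<forall>\<^sub>F z in nhds zb. dist (g z) 0 < r * norm a / 4"
    using limg r anz by (intro tendstoD) auto
  from near_product[OF this] obtain d5 where d5: "d5 > 0"
    "\<And>x w. dist x xbar < d5 \<Longrightarrow> dist w wbar < d5 \<Longrightarrow> norm (g (x, w)) < r * norm a / 4"
    by auto
  define U where "U = ball xbar (min (r / 2) d5)"
  define V where "V = ball wbar (min \<rho> d5)"
  \<comment> \<open>The modulus has to be positive even when \<open>L = 0\<close>.\<close>
  define m where "m = 2 * L + 1"
  have m: "m > 0" unfolding m_def using L by simp
  have main: "x' \<in> {y + (m * norm (w' - w)) *\<^sub>R b | y b. y \<in> stationary_set f0 F w \<and> b \<in> cball 0 1}"
    if w: "w \<in> V" "w' \<in> V" and x': "x' \<in> stationary_set f0 F w'" "x' \<in> U" for w w' x'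
  proof -
    have dx': "dist x' xbar < r / 2" "dist x' xbar < d5" "dist x' xbar < d4"
      using x'(2) r s by (auto simp: U_def dist_commute)
    have dw: "dist w' wbar < d5" "dist w' wbar < d4" "dist w wbar < d4"
      using w \<rho> s by (auto simp: V_def dist_commute)
    have A'nz: "A (x', w') \<noteq> 0" using A_lower[OF dx'(3) dw(2)] anz by auto
    then obtain l' where l': "l' \<ge> 0" "g (x', w') + l' *\<^sub>R A (x', w') = 0" "l' * F (x', w') = 0"
      and F': "F (x', w') \<le> 0"
      using x'(1) stationary_set_iff[OF F, of x' w' f0] by (auto simp: A_def g_def)
    have "l' * (norm a / 2) \<le> l' * norm (A (x', w'))"
      using l'(1) A_lower[OF dx'(3) dw(2)] by (intro mult_left_mono)
    also have "\<dots> = norm (l' *\<^sub>R A (x', w'))" using l'(1) by simp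
    also have "l' *\<^sub>R A (x', w') = - g (x', w')" using l'(2) by (simp add: eq_neg_iff_add_eq_0 add.commute)
    also have "norm (- g (x', w')) < (r / 2) * (norm a / 2)" using d5(2)[OF dx'(2) dw(1)] by simp
    finally have "l' < r / 2" using anz by simp
    then have "(x', l') \<in> cball (xbar, 0) r"
      using norm_Pair_le[of "xbar - x'" "- l'"] dx'(1) l'(1) by (simp add: dist_norm norm_minus_commute)
    moreover have "T w' (x', l') = (x', l')" using T_fix l' F' by blast
    moreover have "w \<in> ball wbar \<rho>" "w' \<in> ball wbar \<rho>" using w by (auto simp: V_def)
    ultimately obtain z where z: "z \<in> cball (xbar, 0) r" "T w z = z"
      "norm (z - (x', l')) \<le> 2 * L * norm (w - w')"
      using fp by blast
    obtain x l where zz: "z = (x, l)" by (cases z)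
    have "dist x xbar < d4"
      using z(1) r s dist_fst_le[of "(x, l)" "(xbar, 0)"] by (simp add: zz dist_commute)
    then have "A (x, w) \<noteq> 0" using A_lower[of x w] dw(3) anz by auto
    moreover have "g (x, w) + l *\<^sub>R A (x, w) = 0 \<and> l \<ge> 0 \<and> F (x, w) \<le> 0 \<and> l * F (x, w) = 0"
      using z(2) T_fix by (simp add: zz)
    ultimately have xS: "x \<in> stationary_set f0 F w"
      using stationary_set_iff[OF F, of x w f0] by (auto simp: A_def g_def)
    have "norm (x' - x) \<le> norm (z - (x', l'))"
      using norm_fst_le[of "x - x'" "l - l'"] by (simp add: zz norm_minus_commute)
    also have "\<dots> \<le> 2 * L * norm (w' - w)" using z(3) by (simp add: norm_minus_commute)
    also have "\<dots> \<le> m * norm (w' - w)" unfolding m_def by (intro mult_right_mono) auto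
    finally have le: "norm (x' - x) \<le> m * norm (w' - w)" .
    define c where "c = m * norm (w' - w)"
    have c: "norm (x' - x) \<le> c" "c \<ge> 0" using le m by (simp_all add: c_def)
    \<comment> \<open>If \<open>c = 0\<close> then \<open>x' = x\<close>, and \<open>b\<close> is
      zero because scaling by the inverse of zero gives zero.\<close>
    define b where "b = (x' - x) /\<^sub>R c"
    have "x' = x + c *\<^sub>R b" "b \<in> cball 0 1"
      using c by (cases "c = 0"; simp add: b_def divide_simps)+
    then have "x' = x + (m * norm (w' - w)) *\<^sub>R b" "b \<in> cball 0 1" by (simp_all add: c_def)
    then show ?thesis using xS by blast
  qed
  show ?thesis
    unfolding locally_lipschitz_like_def
  proof (intro conjI exI[of _ m] exI[of _ U] exI[of _ V] xS m ballI subsetI)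
    show "xbar \<in> interior U" "wbar \<in> interior V"
      unfolding U_def V_def using r \<rho> d5 by (simp_all add: interior_open)
  qed (use main in blast)
qed

section \<open>Vanishing multiplier and kernel conditions in analytic form\<close>

lemma lagrange_multiplier_zeroD:
  fixes f0 F :: "(real^'n) \<times> (real^'d) \<Rightarrow> real"
  assumes F: "twice_continuously_differentiable F" and nz: "grad_x F x w \<noteq> 0"
    and x: "x \<in> stationary_set f0 F w" and l0: "lagrange_multiplier f0 F x w = 0"
  shows "grad_x f0 x w = 0"
proof -
  obtain l where l: "l \<ge> 0" "grad_x f0 x w + l *\<^sub>R grad_x F x w = 0"
    using x stationary_set_iff[OF F nz] by blast
  have "lagrange_multiplier f0 F x w = l"
    unfolding lagrange_multiplier_def
  proof (rule the_equality)
    fix k assume "0 \<le> k \<and> grad_x f0 x w + k *\<^sub>R grad_x F x w = 0"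
    then have "k *\<^sub>R grad_x F x w = l *\<^sub>R grad_x F x w" using l by (metis add_left_imp_eq)
    then show "k = l" using nz by simp
  qed (use l in simp)
  then show ?thesis using l l0 by simp
qed

text \<open>A solution of \<open>H *v v + \<gamma> *\<^sub>R a = 0\<close> meeting one of the sign
  conditions lies in both kernels and hence vanishes. Each failure of strong regularity would
  produce a nonzero solution of this kind.\<close>

lemma kernel_conditions_imp_strongly_regular:
  fixes H :: "real^'n^'n" and B :: "real^'n^'d" and a :: "real^'n" and b :: "real^'d"
  assumes trivial: "\<And>v \<gamma>. H *v v + \<gamma> *\<^sub>R a = 0 \<Longrightarrow> B *v v + \<gamma> *\<^sub>R b = 0 \<Longrightarrow> v = 0 \<and> \<gamma> = 0"
    and zero: "\<And>v \<gamma>. H *v v + \<gamma> *\<^sub>R a = 0 \<Longrightarrow> inner a v = 0 \<Longrightarrow> B *v v + \<gamma> *\<^sub>R b = 0"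
    and pos: "\<And>v \<gamma>. H *v v + \<gamma> *\<^sub>R a = 0 \<Longrightarrow> inner a v > 0 \<Longrightarrow> \<gamma> \<ge> 0 \<Longrightarrow> B *v v + \<gamma> *\<^sub>R b = 0"
    and neg: "\<And>v. H *v v = 0 \<Longrightarrow> inner a v < 0 \<Longrightarrow> B *v v = 0"
  shows "\<exists>G. linear G \<and> (\<forall>v. G (H *v v) = v) \<and> (\<forall>v. H *v G v = v) \<and> inner a (G a) > 0"
proof -
  \<comment> \<open>with \<open>\<gamma> = 0\<close> the three sign cases of \<open>\<langle>a, v\<rangle>\<close> are covered by \<open>pos\<close>, \<open>zero\<close> and \<open>neg\<close>\<close>
  have "v = 0" if "H *v v = 0" for v
  proof -
    have "B *v v = 0"
      using that zero[of v 0] pos[of v 0] neg[of v] by (cases "inner a v" "0::real" rule: linorder_cases) auto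
    then show ?thesis using trivial[of v 0] that by simp
  qed
  then have "inj ((*v) H)"
    by (simp add: linear_injective_0)
  then obtain G where G: "linear G" "\<And>v. G (H *v v) = v" "\<And>v. H *v G v = v"
    using linear_injective_isomorphism[of "(*v) H"] by auto
  \<comment> \<open>A negative value is refuted by the pair \<open>(- G a, 1)\<close>. The value
    zero is refuted by \<open>(G a, -1)\<close>, admissible because \<open>zero\<close> leaves the
    sign of \<open>\<gamma>\<close> free.\<close>
  have "inner a (G a) > 0"
  proof (cases "inner a (G a)" "0::real" rule: linorder_cases)
    case less
    then have "- G a = 0 \<and> (1::real) = 0"
      using pos[of "- G a" 1] by (intro trivial) (simp_all add: linear_neg[OF matrix_vector_mul_linear] G)
    then show ?thesis by simp
  next
    case equal
    then have "G a = 0 \<and> (-1::real) = 0"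
      using zero[of "G a" "-1"] by (intro trivial) (simp_all add: G)
    then show ?thesis by simp
  qed
  with G show ?thesis by blast
qed

theorem theorem4p2:
  fixes f0 F :: "(real^'n) \<times> (real^'d) \<Rightarrow> real"
    and xbar :: "real^'n" and wbar :: "real^'d"
  assumes "twice_continuously_differentiable f0"
    and "twice_continuously_differentiable F"
    and "xbar \<in> stationary_set f0 F wbar"
    and "F (xbar, wbar) = 0"
    and "grad_x F xbar wbar \<noteq> 0"
    and "lagrange_multiplier f0 F xbar wbar = 0"
  shows
    "(locally_lipschitz_like (stationary_set f0 F) wbar xbar \<longrightarrow>
        ker (A1 f0 F xbar wbar) \<inter> Delta3 F xbar wbar \<subseteq> ker (A2 f0 F xbar wbar))
     \<and>
     (ker (A1 f0 F xbar wbar) \<inter> ker (A2 f0 F xbar wbar) = {0} \<and>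
      ker (A1 f0 F xbar wbar) \<inter> (ker (\<lambda>v. inner (grad_x F xbar wbar) v) \<times> UNIV)
        \<subseteq> ker (A2 f0 F xbar wbar) \<and>
      ker (A1 f0 F xbar wbar) \<inter> Delta1 F xbar wbar \<subseteq> ker (A2 f0 F xbar wbar) \<and>
      ker (\<lambda>v. hess_xx f0 xbar wbar *v v) \<inter> Delta2 F xbar wbar
        \<subseteq> ker (\<lambda>v. hess_wx f0 xbar wbar *v v)
      \<longrightarrow> locally_lipschitz_like (stationary_set f0 F) wbar xbar)"
proof (intro conjI impI)
  note g0 = lagrange_multiplier_zeroD[OF assms(2,5,3,6)]
  note defs = ker_def A1_def A2_def augmented_def Delta1_def Delta2_def Delta3_def
  {
    assume lip: "locally_lipschitz_like (stationary_set f0 F) wbar xbar"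
    show "ker (A1 f0 F xbar wbar) \<inter> Delta3 F xbar wbar \<subseteq> ker (A2 f0 F xbar wbar)"
      using lipschitz_like_imp_kernel[OF assms(1,2,4,5) g0 lip] by (auto simp: defs)
  }
  assume cond: "ker (A1 f0 F xbar wbar) \<inter> ker (A2 f0 F xbar wbar) = {0} \<and>
      ker (A1 f0 F xbar wbar) \<inter> (ker (\<lambda>v. inner (grad_x F xbar wbar) v) \<times> UNIV)
        \<subseteq> ker (A2 f0 F xbar wbar) \<and>
      ker (A1 f0 F xbar wbar) \<inter> Delta1 F xbar wbar \<subseteq> ker (A2 f0 F xbar wbar) \<and>
      ker (\<lambda>v. hess_xx f0 xbar wbar *v v) \<inter> Delta2 F xbar wbar
        \<subseteq> ker (\<lambda>v. hess_wx f0 xbar wbar *v v)"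
  let ?H = "hess_xx f0 xbar wbar" and ?B = "hess_wx f0 xbar wbar"
  let ?a = "grad_x F xbar wbar" and ?b = "grad_w F xbar wbar"
  have trivial: "v = 0 \<and> \<gamma> = 0" if "?H *v v + \<gamma> *\<^sub>R ?a = 0" "?B *v v + \<gamma> *\<^sub>R ?b = 0" for v \<gamma>
  proof -
    have "(v, \<gamma>) \<in> ker (A1 f0 F xbar wbar) \<inter> ker (A2 f0 F xbar wbar)" using that by (simp add: defs)
    then show ?thesis using cond by (simp add: zero_prod_def)
  qed
  have zero: "?B *v v + \<gamma> *\<^sub>R ?b = 0" if "?H *v v + \<gamma> *\<^sub>R ?a = 0" "inner ?a v = 0" for v \<gamma>
  proof -
    have "(v, \<gamma>) \<in> ker (A1 f0 F xbar wbar) \<inter> (ker (\<lambda>v. inner ?a v) \<times> UNIV)"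
      using that by (simp add: defs)
    then have "(v, \<gamma>) \<in> ker (A2 f0 F xbar wbar)" using cond by blast
    then show ?thesis by (simp add: defs)
  qed
  have pos: "?B *v v + \<gamma> *\<^sub>R ?b = 0"
    if "?H *v v + \<gamma> *\<^sub>R ?a = 0" "inner ?a v > 0" "\<gamma> \<ge> 0" for v \<gamma>
  proof -
    have "(v, \<gamma>) \<in> ker (A1 f0 F xbar wbar) \<inter> Delta1 F xbar wbar" using that by (simp add: defs)
    then have "(v, \<gamma>) \<in> ker (A2 f0 F xbar wbar)" using cond by blast
    then show ?thesis by (simp add: defs)
  qed
  have neg: "?B *v v = 0" if "?H *v v = 0" "inner ?a v < 0" for v
    using cond that by (auto simp: ker_def Delta2_def)
  obtain G where "linear G" "\<And>v. G (?H *v v) = v" "\<And>v. ?H *v G v = v" "inner ?a (G ?a) > 0"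
    using kernel_conditions_imp_strongly_regular[OF trivial zero pos neg] by blast
  then show "locally_lipschitz_like (stationary_set f0 F) wbar xbar"
    by (rule strongly_regular_imp_lipschitz_like[OF assms(1,2,4,5) g0])
qed

end
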